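(* Let $\mathcal{C}(k)$ be any subclass of $k$-juntas over $\{0,1\}^n$, and let $0<\varepsilon<1/2$. There is a relative-error $\varepsilon$-testing algorithm for $\mathcal{C}(k)$ that makes $\tilde{O}\big(k\log|\mathcal{C}(k)^*|/\varepsilon\big)$ total calls to its oracles (membership queries and random satisfying-assignment samples).
   Context: A function $f:\{0,1\}^n\to\{0,1\}$ is a $k$-junta if it depends on at most $k$ of its input variables. A class $\mathcal{C}(k)$ of functions $\{0,1\}^n\to\{0,1\}$ is a subclass of $k$-juntas if (i) every $f\in\mathcal{C}(k)$ is a $k$-junta and (ii) $\mathcal{C}(k)$ is closed under permuting variables: if $f\in\mathcal{C}(k)$ and $\pi:[n]\to[n]$ is a permutation then $x\mapsto f(x_{\pi(1)},\dots,x_{\pi(n)})$ is in $\mathcal{C}(k)$. $\mathcal{C}(k)^*=\{f\in\mathcal{C}(k): f \text{ does not depend on } x_{k+1},\dots,x_n\}$. For $f,g$ with $f^{-1}(1)\ne\emptyset$, $\mathrm{rel\text{-}dist}(f,g)=|f^{-1}(1)\triangle g^{-1}(1)|/|f^{-1}(1)|$ and $\mathrm{rel\text{-}dist}(f,\mathcal{C})=\min_{g\in\mathcal{C}}\mathrm{rel\text{-}dist}(f,g)$. A relative-error $\varepsilon$-testing algorithm for $\mathcal{C}$ has black-box query access to $f$ and access to independent uniform samples from $f^{-1}(1)$; it must accept with probability at least $2/3$ if $f\in\mathcal{C}$ and reject with probability at least $2/3$ if $\mathrm{rel\text{-}dist}(f,\mathcal{C})\ge\varepsilon$. $\tilde{O}$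 hides polylogarithmic factors.
   Formalization: In the bound, k and log|C(k)^*| are each read as at least 1 (log base 2), since the literal product vanishes for k = 0 or |C(k)^*| ≤ 1, where calls can still be needed (e.g. C = {constant 1}); f ranges over functions with a satisfying assignment. *)

theory Defs
  imports "HOL-Probability.Probability" "HOL-Combinatorics.Permutations"
begin

(* The n coordinates of a point are indexed by 0, ..., n - 1, and n is an explicit
   parameter, not a type, so that constants can be asserted to be uniform in n.
   Points and Boolean functions are extensional: functions that agree on the cube are
   equal, so classes of functions are finite and their cardinality is the intended one. *)

type_synonym point = "nat \<Rightarrow> bool"
type_synonym boolfun = "point \<Rightarrow> bool"

definition cube :: "nat \<Rightarrow> point set" where
  "cube n = ({..<n} \<rightarrow>\<^sub>E UNIV)"

definition boolfuns :: "nat \<Rightarrow> boolfun set" where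
  "boolfuns n = (cube n \<rightarrow>\<^sub>E UNIV)"

definition depends_on :: "nat \<Rightarrow> boolfun \<Rightarrow> nat \<Rightarrow> bool" where
  "depends_on n f i \<longleftrightarrow> i < n \<and> (\<exists>x\<in>cube n. f x \<noteq> f (x(i := \<not> x i)))"

definition is_junta :: "nat \<Rightarrow> nat \<Rightarrow> boolfun \<Rightarrow> bool" where
  "is_junta n k f \<longleftrightarrow> card {i. depends_on n f i} \<le> k"

definition permute_vars :: "nat \<Rightarrow> (nat \<Rightarrow> nat) \<Rightarrow> boolfun \<Rightarrow> boolfun" where
  "permute_vars n \<pi> f = (\<lambda>x\<in>cube n. f (\<lambda>i. x (\<pi> i)))"

definition junta_subclass :: "nat \<Rightarrow> nat \<Rightarrow> boolfun set \<Rightarrow> bool" where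
  "junta_subclass n k C \<longleftrightarrow>
     C \<subseteq> boolfuns n \<and>
     (\<forall>f\<in>C. is_junta n k f) \<and>
     (\<forall>f\<in>C. \<forall>\<pi>. \<pi> permutes {..<n} \<longrightarrow> permute_vars n \<pi> f \<in> C)"

(* The class written C(k)^* : with indices starting at 0, the variables x_(k+1), ..., x_n
   are those with index i, k <= i < n. *)
definition first_vars_part :: "nat \<Rightarrow> nat \<Rightarrow> boolfun set \<Rightarrow> boolfun set" where
  "first_vars_part n k C = {f \<in> C. \<forall>i. k \<le> i \<and> i < n \<longrightarrow> \<not> depends_on n f i}"

definition sat :: "nat \<Rightarrow> boolfun \<Rightarrow> point set" where
  "sat n f = {x \<in> cube n. f x}"

definition rel_dist :: "nat \<Rightarrow> boolfun \<Rightarrow> boolfun \<Rightarrow> real" where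
  "rel_dist n f g = real (card (sym_diff (sat n f) (sat n g))) / real (card (sat n f))"

(* The distance to the empty class is infinite. *)
definition rel_dist_class :: "nat \<Rightarrow> boolfun \<Rightarrow> boolfun set \<Rightarrow> ereal" where
  "rel_dist_class n f C = (if C = {} then \<infinity> else ereal (Min (rel_dist n f ` C)))"

(* Randomised adaptive oracle algorithms. Query x asks the black box for f x, Sample asks
   for a uniform satisfying assignment, and Random draws from an arbitrary discrete
   distribution, which is the internal randomness of the algorithm. Every continuation may
   depend on all earlier answers. A query outside the cube is useless, because
   all extensional functions have the same value there. *)
datatype algorithm =
    Output bool
  | Query point "bool \<Rightarrow> algorithm"
  | Sample "point \<Rightarrow> algorithm"
  | Random "nat pmf" "nat \<Rightarrow> algorithm"

primrec run :: "nat \<Rightarrow> boolfun \<Rightarrow> algorithm \<Rightarrow> bool pmf" where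
  "run n f (Output b) = return_pmf b"
| "run n f (Query x K) = run n f (K (f x))"
| "run n f (Sample K) = bind_pmf (pmf_of_set (sat n f)) (\<lambda>x. run n f (K x))"
| "run n f (Random p K) = bind_pmf p (\<lambda>r. run n f (K r))"

(* Worst case over all oracle answers and all internal randomness; only oracle calls
   are counted. *)
primrec calls_le :: "nat \<Rightarrow> algorithm \<Rightarrow> nat \<Rightarrow> bool" where
  "calls_le n (Output b) q \<longleftrightarrow> True"
| "calls_le n (Query x K) q \<longleftrightarrow> q > 0 \<and> (\<forall>b. calls_le n (K b) (q - 1))"
| "calls_le n (Sample K) q \<longleftrightarrow> q > 0 \<and> (\<forall>x\<in>cube n. calls_le n (K x) (q - 1))"
| "calls_le n (Random p K) q \<longleftrightarrow> (\<forall>r\<in>set_pmf p. calls_le n (K r) q)"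

(* The output True means accept. The function f ranges over those with a satisfying
   assignment, since otherwise neither the sampling oracle nor rel_dist is defined. *)
definition rel_error_tester :: "nat \<Rightarrow> boolfun set \<Rightarrow> real \<Rightarrow> algorithm \<Rightarrow> bool" where
  "rel_error_tester n C \<epsilon> alg \<longleftrightarrow>
     (\<forall>f\<in>boolfuns n. sat n f \<noteq> {} \<longrightarrow>
        (f \<in> C \<longrightarrow> pmf (run n f alg) True \<ge> 2 / 3) \<and>
        (rel_dist_class n f C \<ge> ereal \<epsilon> \<longrightarrow> pmf (run n f alg) False \<ge> 2 / 3))"

(* The quantity k log |C(k)^*| / epsilon inside the soft-O. Both factors are read as at
   least 1: the literal product vanishes for k = 0 and if C(k)^* has at most one element, where
   testing can still need oracle calls. Otherwise the maxima have no effect. *)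
definition call_scale :: "nat \<Rightarrow> nat \<Rightarrow> boolfun set \<Rightarrow> real \<Rightarrow> real" where
  "call_scale n k C \<epsilon> =
     max 1 (real k) * max 1 (log 2 (real (card (first_vars_part n k C)))) / \<epsilon>"

end

theory Submission
  imports Defs
begin

text \<open>
  The coordinates are randomly partitioned into about \<open>k\<^sup>2\<close> blocks, which isolates the relevant
  variables of a \<open>k\<close>-junta. Blocks containing relevant variables are found one at a time:
  take \<open>x\<close> from \<open>f\<^sup>-\<^sup>1(1)\<close>, rerandomise it outside the blocks found so far, and whenever the value
  drops to \<open>0\<close> locate a new block by binary search over hybrids. Fixing the coordinates outside a
  found block to its witness restricts \<open>f\<close> to a function which for a \<open>k\<close>-junta is a literal; this is
  tested, and from then on the hidden variable of the block can be read off any point by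
  self-correction. Samples from \<open>f\<^sup>-\<^sup>1(1)\<close> are thus turned into samples over at most \<open>k\<close> abstract
  variables, the missing ones being filled with random bits.

  Among the functions of \<open>C(k)\<^sup>*\<close> consistent with \<open>O(log |C(k)\<^sup>*| / \<epsilon>)\<close> such samples, take one, \<open>g\<close>,
  with fewest satisfying assignments. If \<open>f\<close> is in the class, then \<open>f\<close> itself competes, so
  \<open>|g\<^sup>-\<^sup>1(1)| \<le> |f\<^sup>-\<^sup>1(1)|\<close>; since \<open>g\<close> covers almost all of \<open>f\<^sup>-\<^sup>1(1)\<close>, it is then almost contained
  in it. Hence it suffices to test this single \<open>g\<close> with \<open>O(1/\<epsilon>)\<close> samples from \<open>g\<^sup>-\<^sup>1(1)\<close>, whereas
  an \<open>f\<close> that is far from the class fails one of the two covering tests for every \<open>g\<close>.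
  All tests insist on perfect agreement, so only union bounds are needed.
\<close>

subsection \<open>Probabilities in the monad of discrete distributions\<close>

text \<open>Relative error rules out estimating the density of \<open>f\<close>, which may be
  exponentially small. So \<open>f\<close> and a candidate \<open>h\<close> are compared only
  through \<open>miss n T f h\<close>, the probability that a satisfying assignment of
  \<open>f\<close> falsifies \<open>h\<close> once its coordinates outside \<open>T\<close> are
  rerandomised. With |f| the number of satisfying assignments, |f| (1 - miss f h) = |h| (1 - miss h
  f); this identity lets a comparison of sizes stand in for learning in the other direction.

  The tester never learns which coordinate of a block is the hidden one. It reads that variable by
  self-correction, and it writes it by flipping whole blocks of a random point.

  The cost is set by consistency: all m samples, m of order log |G| / \<epsilon> for the candidate
  set G, must fit the right candidate, so the search has to push \<open>miss n T f f\<close> down to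
  order 1/m. That takes about m trials, up to a logarithm, in each of k + 1 rounds; decoding k
  blocks for each of the m samples costs just as much.\<close>

lemma prob_bind_pmf:
  "measure_pmf.prob (bind_pmf p K) A = (\<integral>x. measure_pmf.prob (K x) A \<partial>measure_pmf p)"
proof -
  have eq: "measure_pmf.prob q A = pmf (map_pmf (\<lambda>x. x \<in> A) q) True" for q
    by (simp add: pmf_def vimage_def)
  show ?thesis
    unfolding eq by (simp add: map_bind_pmf pmf_bind)
qed

lemma integrable_prob_pmf: "integrable (measure_pmf p) (\<lambda>x. measure_pmf.prob (K x) A)"
  by (rule measure_pmf.integrable_const_bound[where B = 1]) auto

text \<open>The union bound in monadic form: bad outcomes \<open>B\<close> of the first stage are
  paid for by their mass, and after any other outcome the later stages contribute at most
  \<open>b\<close>. Chaining it adds up the failure probabilities of the stages of the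
  tester.\<close>

lemma prob_bind_le:
  assumes "0 \<le> b" and "\<And>x. x \<in> set_pmf p \<Longrightarrow> x \<notin> B \<Longrightarrow> measure_pmf.prob (K x) A \<le> b"
  shows "measure_pmf.prob (bind_pmf p K) A \<le> measure_pmf.prob p B + b"
proof -
  have "measure_pmf.prob (bind_pmf p K) A \<le> (\<integral>x. indicator B x + b \<partial>measure_pmf p)"
    unfolding prob_bind_pmf
  proof (rule integral_mono_AE)
    show "integrable (measure_pmf p) (\<lambda>x. indicator B x + b)"
      by (rule measure_pmf.integrable_const_bound[where B = "1 + b"])
        (use assms(1) in \<open>auto simp: indicator_def\<close>)
    show "AE x in measure_pmf p. measure_pmf.prob (K x) A \<le> indicator B x + b"
      using assms by (auto simp: AE_measure_pmf_iff indicator_def intro: order_trans[OF measure_pmf.prob_le_1])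
  qed (rule integrable_prob_pmf)
  also have "\<dots> = measure_pmf.prob p B + b"
    by (subst Bochner_Integration.integral_add)
      (auto intro!: measure_pmf.integrable_const_bound[where B = 1] simp: indicator_def)
  finally show ?thesis .
qed

lemma prob_bind_le_const:
  assumes "0 \<le> b" and "\<And>x. x \<in> set_pmf p \<Longrightarrow> measure_pmf.prob (K x) A \<le> b"
  shows "measure_pmf.prob (bind_pmf p K) A \<le> b"
  using prob_bind_le[of b p "{}" K A] assms by simp

lemma prob_bind_ge:
  assumes "0 \<le> b" and "\<And>x. x \<in> set_pmf p \<Longrightarrow> x \<in> B \<Longrightarrow> b \<le> measure_pmf.prob (K x) A"
  shows "measure_pmf.prob p B * b \<le> measure_pmf.prob (bind_pmf p K) A"
proof -
  have int: "integrable (measure_pmf p) (\<lambda>x. indicator B x * b)"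
    by (rule measure_pmf.integrable_const_bound[where B = b])
      (use assms(1) in \<open>auto simp: indicator_def\<close>)
  have "measure_pmf.prob p B * b = (\<integral>x. indicator B x * b \<partial>measure_pmf p)"
    by simp
  also have "\<dots> \<le> measure_pmf.prob (bind_pmf p K) A"
    unfolding prob_bind_pmf
    by (rule integral_mono_AE[OF int integrable_prob_pmf])
      (use assms in \<open>auto simp: AE_measure_pmf_iff indicator_def\<close>)
  finally show ?thesis .
qed

lemma prob_bind_ge_const:
  assumes "0 \<le> b" and "\<And>x. x \<in> set_pmf p \<Longrightarrow> b \<le> measure_pmf.prob (K x) A"
  shows "b \<le> measure_pmf.prob (bind_pmf p K) A"
  using prob_bind_ge[of b p UNIV K A] assms by simp

lemma prob_bind_return: "measure_pmf.prob (bind_pmf p (\<lambda>x. return_pmf (h x))) A = measure_pmf.prob p {x. h x \<in> A}"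
  by (simp add: map_pmf_def[symmetric] vimage_def)

lemma prob_replicate_pmf_all:
  "measure_pmf.prob (replicate_pmf m p) {xs. \<forall>x\<in>set xs. P x} = measure_pmf.prob p {x. P x} ^ m"
proof (induction m)
  case (Suc m)
  have "measure_pmf.prob (bind_pmf (replicate_pmf m p) (\<lambda>xs. return_pmf (x # xs))) {xs. \<forall>x\<in>set xs. P x}
      = indicator {x. P x} x * measure_pmf.prob p {x. P x} ^ m" for x
    unfolding map_pmf_def[symmetric] using Suc
    by (auto simp: vimage_def indicator_def)
  then show ?case
    by (simp add: prob_bind_pmf)
qed (simp add: indicator_def)

lemma prob_replicate_pmf_ex:
  "measure_pmf.prob (replicate_pmf m p) {xs. \<exists>x\<in>set xs. P x} \<le> real m * measure_pmf.prob p {x. P x}"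
proof (induction m)
  case (Suc m)
  have *: "measure_pmf.prob (bind_pmf (replicate_pmf m p) (\<lambda>xs. return_pmf (x # xs))) {xs. \<exists>x\<in>set xs. P x}
      \<le> real m * measure_pmf.prob p {x. P x}" if "\<not> P x" for x
    unfolding map_pmf_def[symmetric] using Suc that by (auto simp: vimage_def)
  have "measure_pmf.prob (replicate_pmf (Suc m) p) {xs. \<exists>x\<in>set xs. P x}
      \<le> measure_pmf.prob p {x. P x} + real m * measure_pmf.prob p {x. P x}"
    unfolding replicate_pmf.simps by (rule prob_bind_le) (use * in auto)
  then show ?case
    by (simp add: algebra_simps)
qed (simp add: indicator_def)

lemma prob_compl_pmf: "measure_pmf.prob p {x. \<not> P x} = 1 - measure_pmf.prob p {x. P x}"
  using measure_pmf.prob_compl[of "{x. P x}" p] by (simp add: Compl_eq_Diff_UNIV[symmetric] Collect_neg_eq)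

lemma prob_mono_pmf:
  assumes "\<And>x. x \<in> set_pmf p \<Longrightarrow> P x \<Longrightarrow> Q x"
  shows "measure_pmf.prob p {x. P x} \<le> measure_pmf.prob p {x. Q x}"
  by (rule measure_pmf.finite_measure_mono_AE) (use assms in \<open>auto simp: AE_measure_pmf_iff\<close>)

lemma prob_cong_pmf:
  assumes "\<And>x. x \<in> set_pmf p \<Longrightarrow> P x \<longleftrightarrow> Q x"
  shows "measure_pmf.prob p {x. P x} = measure_pmf.prob p {x. Q x}"
  using assms by (intro antisym prob_mono_pmf) auto

lemma prob_disj_pmf:
  "measure_pmf.prob p {x. P x \<or> Q x} \<le> measure_pmf.prob p {x. P x} + measure_pmf.prob p {x. Q x}"
  using measure_Un_le[of "{x. P x}" "measure_pmf p" "{x. Q x}"] by (simp add: Un_def)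

text \<open>An Occam bound: one bad hypothesis survives \<open>m\<close> independent samples with
  probability at most \<open>a ^ m\<close>, so \<open>m\<close> logarithmic in \<open>card H\<close>
  eliminates all of them at once. This is the origin of the logarithm of the class size in the call
  count.\<close>

lemma prob_replicate_pmf_union:
  assumes "finite H" and "\<And>g. g \<in> H \<Longrightarrow> measure_pmf.prob p {x. P g x} \<le> a"
  shows "measure_pmf.prob (replicate_pmf m p) {xs. \<exists>g\<in>H. \<forall>x\<in>set xs. P g x} \<le> real (card H) * a ^ m"
proof -
  have "{xs. \<exists>g\<in>H. \<forall>x\<in>set xs. P g x} = (\<Union>g\<in>H. {xs. \<forall>x\<in>set xs. P g x})"
    by auto
  then have "measure_pmf.prob (replicate_pmf m p) {xs. \<exists>g\<in>H. \<forall>x\<in>set xs. P g x}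
      \<le> (\<Sum>g\<in>H. measure_pmf.prob (replicate_pmf m p) {xs. \<forall>x\<in>set xs. P g x})"
    using measure_pmf.finite_measure_subadditive_finite[OF assms(1), of "\<lambda>g. {xs. \<forall>x\<in>set xs. P g x}"]
    by simp
  also have "\<dots> \<le> (\<Sum>g\<in>H. a ^ m)"
    by (intro sum_mono) (auto simp: prob_replicate_pmf_all intro!: power_mono assms)
  finally show ?thesis
    by simp
qed

subsection \<open>Oracle computations\<close>

text \<open>A procedure is in continuation-passing style, so that procedures can be sequenced although the type
  of algorithms only has Boolean outputs.\<close>

definition computes :: "nat \<Rightarrow> (boolfun \<Rightarrow> 'a pmf) \<Rightarrow> nat \<Rightarrow> bool" where
  "computes n D c \<longleftrightarrow>
     (\<exists>P :: ('a \<Rightarrow> algorithm) \<Rightarrow> algorithm.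
        (\<forall>K f. run n f (P K) = bind_pmf (D f) (\<lambda>a. run n f (K a))) \<and>
        (\<forall>K q. (\<forall>a. calls_le n (K a) q) \<longrightarrow> calls_le n (P K) (c + q)))"

lemma computesI:
  assumes "\<And>K f. run n f (P K) = bind_pmf (D f) (\<lambda>a. run n f (K a))"
    and "\<And>K q. (\<And>a. calls_le n (K a) q) \<Longrightarrow> calls_le n (P K) (c + q)"
  shows "computes n D c"
  unfolding computes_def using assms by (intro exI[of _ P]) auto

lemma calls_le_mono: "calls_le n alg q \<Longrightarrow> q \<le> q' \<Longrightarrow> calls_le n alg q'"
proof (induction alg arbitrary: q q')
  case (Query x K)
  have "calls_le n (K b) (q' - 1)" for b
    by (rule Query.IH[of "K b" "q - 1"]) (use Query.prems in auto)
  then show ?case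
    using Query.prems by auto
next
  case (Sample K)
  have "calls_le n (K x) (q' - 1)" if "x \<in> cube n" for x
    by (rule Sample.IH[of "K x" "q - 1"]) (use Sample.prems that in auto)
  then show ?case
    using Sample.prems by auto
next
  case (Random p K)
  have "calls_le n (K r) q'" if "r \<in> set_pmf p" for r
    by (rule Random.IH[of "K r" q]) (use Random.prems that in auto)
  then show ?case
    by auto
qed auto

lemma computes_return: "computes n (\<lambda>f. return_pmf a) 0"
  by (rule computesI[where P = "\<lambda>K. K a"]) (auto simp: bind_return_pmf)

lemma computes_query: "computes n (\<lambda>f. return_pmf (f x)) 1"
  by (rule computesI[where P = "\<lambda>K. Query x K"]) (auto simp: bind_return_pmf)

lemma computes_sample: "computes n (\<lambda>f. pmf_of_set (sat n f)) 1"
  by (rule computesI[where P = "\<lambda>K. Sample K"]) auto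

text \<open>\<open>Random\<close> draws natural numbers only, so a distribution on another type is
  sent through the enumeration of its support, which is countable for every \<open>pmf\<close>, and
  decoded in the continuation.\<close>

lemma computes_random: "computes n (\<lambda>f. p) 0"
proof (rule computesI)
  let ?P = "\<lambda>K. Random (map_pmf (to_nat_on (set_pmf p)) p) (\<lambda>r. K (from_nat_into (set_pmf p) r))"
  show "run n f (?P K) = bind_pmf p (\<lambda>a. run n f (K a))" for K f
    by (auto simp: bind_map_pmf intro!: bind_pmf_cong)
  show "calls_le n (?P K) (0 + q)" if "\<And>a. calls_le n (K a) q" for K q
    using that by simp
qed

lemma computes_bind:
  assumes D: "computes n D c" and E: "\<And>a. computes n (E a) d"
  shows "computes n (\<lambda>f. bind_pmf (D f) (\<lambda>a. E a f)) (c + d)"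
proof -
  obtain P where P: "\<And>K f. run n f (P K) = bind_pmf (D f) (\<lambda>a. run n f (K a))"
    "\<And>K q. (\<And>a. calls_le n (K a) q) \<Longrightarrow> calls_le n (P K) (c + q)"
    using D unfolding computes_def by metis
  obtain Q where Q: "\<And>a K f. run n f (Q a K) = bind_pmf (E a f) (\<lambda>b. run n f (K b))"
    "\<And>a K q. (\<And>b. calls_le n (K b) q) \<Longrightarrow> calls_le n (Q a K) (d + q)"
    using E unfolding computes_def by metis
  show ?thesis
    by (rule computesI[where P = "\<lambda>K. P (\<lambda>a. Q a K)"])
      (auto simp: P(1) Q(1) bind_assoc_pmf add.assoc intro: P(2) Q(2))
qed

lemma computes_mono:
  assumes "computes n D c" "c \<le> d"
  shows "computes n D d"
proof -
  obtain P where P: "\<And>K f. run n f (P K) = bind_pmf (D f) (\<lambda>a. run n f (K a))"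
    "\<And>K q. (\<And>a. calls_le n (K a) q) \<Longrightarrow> calls_le n (P K) (c + q)"
    using assms(1) unfolding computes_def by metis
  show ?thesis
  proof (rule computesI[where P = P])
    show "calls_le n (P K) (d + q)" if "\<And>a. calls_le n (K a) q" for K q
      using calls_le_mono[OF P(2)[OF that]] assms(2) by simp
  qed (rule P(1))
qed

lemma computes_bind_random:
  assumes "\<And>a. computes n (E a) d"
  shows "computes n (\<lambda>f. bind_pmf p (\<lambda>a. E a f)) d"
  using computes_bind[OF computes_random assms] by simp

lemma computes_map:
  assumes "computes n D c"
  shows "computes n (\<lambda>f. map_pmf h (D f)) c"
  using computes_bind[OF assms, of "\<lambda>a f. return_pmf (h a)" 0]
  by (simp add: computes_return map_pmf_def)

lemma computes_map2:
  assumes "computes n (\<lambda>f. return_pmf (a f)) c" "computes n (\<lambda>f. return_pmf (b f)) d"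
  shows "computes n (\<lambda>f. return_pmf (h (a f) (b f))) (c + d)"
proof -
  have "computes n (\<lambda>f. map_pmf (h x) (return_pmf (b f))) d" for x
    by (rule computes_map[OF assms(2)])
  from computes_bind[OF assms(1) this] show ?thesis
    by (simp add: bind_return_pmf)
qed

lemma computes_map1:
  assumes "computes n (\<lambda>f. return_pmf (a f)) c"
  shows "computes n (\<lambda>f. return_pmf (h (a f))) c"
  using computes_map[OF assms, of h] by simp

lemma computes_replicate:
  assumes "computes n D c"
  shows "computes n (\<lambda>f. replicate_pmf m (D f)) (m * c)"
proof (induction m)
  case (Suc m)
  show ?case
    using computes_bind[OF assms computes_map[OF Suc], of "\<lambda>x xs. x # xs"]
    by (simp add: map_pmf_def)
qed (simp add: computes_return)

lemma computes_if:
  assumes "b \<Longrightarrow> computes n D c" "\<not> b \<Longrightarrow> computes n E c"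
  shows "computes n (\<lambda>f. if b then D f else E f) c"
  using assms by (cases b) auto

lemma computes_algorithm:
  assumes "computes n D c"
  obtains alg where "\<And>f. run n f alg = D f" "calls_le n alg c"
proof -
  obtain P where P: "\<And>K f. run n f (P K) = bind_pmf (D f) (\<lambda>a. run n f (K a))"
    "\<And>K q. (\<And>a. calls_le n (K a) q) \<Longrightarrow> calls_le n (P K) (c + q)"
    using assms unfolding computes_def by metis
  show thesis
  proof
    show "run n f (P Output) = D f" for f
      by (simp add: P(1) bind_return_pmf')
    show "calls_le n (P Output) c"
      using P(2)[of Output 0] by simp
  qed
qed

subsection \<open>Points of the cube\<close>

definition mix :: "nat set \<Rightarrow> point \<Rightarrow> point \<Rightarrow> point" where
  "mix S x y = (\<lambda>i. if i \<in> S then x i else y i)"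

definition xorp :: "nat \<Rightarrow> point \<Rightarrow> point \<Rightarrow> point" where
  "xorp n x y = (\<lambda>i\<in>{..<n}. x i \<noteq> y i)"

definition andp :: "nat \<Rightarrow> point \<Rightarrow> point \<Rightarrow> point" where
  "andp n x y = (\<lambda>i\<in>{..<n}. x i \<and> y i)"

definition onep :: "nat \<Rightarrow> point" where
  "onep n = (\<lambda>i\<in>{..<n}. True)"

definition unitp :: "nat \<Rightarrow> nat \<Rightarrow> point" where
  "unitp n j = (\<lambda>i\<in>{..<n}. i = j)"

definition unif :: "nat \<Rightarrow> point pmf" where
  "unif n = pmf_of_set (cube n)"

lemma finite_cube [simp]: "finite (cube n)"
  by (auto simp: cube_def intro!: finite_PiE)

lemma cube_nonempty [simp]: "cube n \<noteq> {}"
  by (auto simp: cube_def PiE_eq_empty_iff)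

lemma set_unif [simp]: "set_pmf (unif n) = cube n"
  by (simp add: unif_def)

lemma cube_ext: "x \<in> cube n \<Longrightarrow> y \<in> cube n \<Longrightarrow> (\<And>i. i < n \<Longrightarrow> x i = y i) \<Longrightarrow> x = y"
  unfolding cube_def by (rule PiE_ext) auto

lemma in_cube_iff: "x \<in> cube n \<longleftrightarrow> (\<forall>i. \<not> i < n \<longrightarrow> x i = undefined)"
  by (auto simp: cube_def PiE_def extensional_def)

lemma mix_in_cube [simp]: "x \<in> cube n \<Longrightarrow> y \<in> cube n \<Longrightarrow> mix S x y \<in> cube n"
  by (auto simp: in_cube_iff mix_def)

lemma xorp_in_cube [simp]: "xorp n x y \<in> cube n"
  and andp_in_cube [simp]: "andp n x y \<in> cube n"
  and onep_in_cube [simp]: "onep n \<in> cube n"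
  and unitp_in_cube [simp]: "unitp n j \<in> cube n"
  by (auto simp: in_cube_iff xorp_def andp_def onep_def unitp_def)

lemma xorp_comm: "xorp n x y = xorp n y x"
  by (auto simp: xorp_def)

lemma xorp_assoc: "xorp n (xorp n x y) z = xorp n x (xorp n y z)"
  by (rule cube_ext[where n = n]) (simp_all, auto simp: xorp_def)

lemma xorp_cancel [simp]: "x \<in> cube n \<Longrightarrow> xorp n (xorp n x y) y = x"
  by (rule cube_ext[where n = n]) (simp_all, auto simp: xorp_def)

lemma bij_betw_involution:
  assumes "\<And>x. x \<in> A \<Longrightarrow> h x \<in> A" "\<And>x. x \<in> A \<Longrightarrow> h (h x) = x"
  shows "bij_betw h A A"
  by (rule bij_betw_byWitness[where f' = h]) (use assms in auto)

lemma map_pmf_unif_bij: "bij_betw h (cube n) (cube n) \<Longrightarrow> map_pmf h (unif n) = unif n"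
  unfolding unif_def by (rule map_pmf_of_set_bij_betw) auto

lemma prob_unif_bij:
  assumes "bij_betw h (cube n) (cube n)"
  shows "measure_pmf.prob (unif n) {x. P (h x)} = measure_pmf.prob (unif n) {x. P x}"
proof -
  have "measure_pmf.prob (unif n) {x. P x} = measure_pmf.prob (map_pmf h (unif n)) {x. P x}"
    using assms by (simp only: map_pmf_unif_bij)
  then show ?thesis
    by (simp add: vimage_def)
qed

lemma bij_betw_xorp: "bij_betw (\<lambda>z. xorp n z x) (cube n) (cube n)"
  by (rule bij_betw_involution) auto

lemma prob_unif_xorp: "measure_pmf.prob (unif n) {z. P (xorp n z x)} = measure_pmf.prob (unif n) {z. P z}"
  using prob_unif_bij[OF bij_betw_xorp] .

subsection \<open>Testing for dictators\<close>

text \<open>If \<open>F\<close> is a literal on the variable \<open>i\<close>, then \<open>dec n F x z\<close> is \<open>x i\<close> for every \<open>z\<close>, whether or not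
  the literal is negated.\<close>

definition dec :: "nat \<Rightarrow> boolfun \<Rightarrow> point \<Rightarrow> point \<Rightarrow> bool" where
  "dec n F x z \<longleftrightarrow> F z \<noteq> F (xorp n z x)"

definition dec_err :: "nat \<Rightarrow> boolfun \<Rightarrow> point \<Rightarrow> bool \<Rightarrow> real" where
  "dec_err n F x b = measure_pmf.prob (unif n) {z. dec n F x z \<noteq> b}"

text \<open>The dictators are the Boolean algebra homomorphisms from the cube to the truth values: the three
  conditions test consistency (hence additivity), multiplicativity, and preservation of the top element.\<close>

definition round_ok :: "nat \<Rightarrow> boolfun \<Rightarrow> point \<Rightarrow> point \<Rightarrow> point \<Rightarrow> point \<Rightarrow> bool" where
  "round_ok n F x y z z' \<longleftrightarrow> dec n F x z = dec n F x z' \<and>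
     dec n F (andp n x y) z = (dec n F x z \<and> dec n F y z) \<and> dec n F (onep n) z"

definition dictator_round :: "nat \<Rightarrow> boolfun \<Rightarrow> bool pmf" where
  "dictator_round n F =
     bind_pmf (unif n) (\<lambda>x. bind_pmf (unif n) (\<lambda>y. bind_pmf (unif n) (\<lambda>z. bind_pmf (unif n) (\<lambda>z'.
       return_pmf (round_ok n F x y z z')))))"

lemma dec_err_not: "dec_err n F x (\<not> b) = 1 - dec_err n F x b"
proof -
  have "dec_err n F x (\<not> b) = measure_pmf.prob (unif n) {z. \<not> (dec n F x z \<noteq> b)}"
    unfolding dec_err_def by (rule arg_cong[where f = "measure_pmf.prob (unif n)"]) auto
  then show ?thesis
    unfolding dec_err_def prob_compl_pmf .
qed

lemma dec_err_neq: "b \<noteq> c \<Longrightarrow> dec_err n F x b = 1 - dec_err n F x c"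
  using dec_err_not[of n F x c] by (cases b; cases c) auto

text \<open>Over GF(2), \<open>dec n F x z\<close> is the derivative F(z) + F(z + x), and
  derivatives telescope along z, z + x, z + x + y.\<close>

lemma dec_xorp:
  "z \<in> cube n \<Longrightarrow> dec n F (xorp n x y) z \<longleftrightarrow> dec n F x z \<noteq> dec n F y (xorp n z x)"
  by (auto simp: dec_def xorp_assoc)

text \<open>If z is uniform, so is z + x; hence each of the two telescoped derivatives errs with its
  own probability.\<close>

lemma dec_err_xorp: "dec_err n F (xorp n x y) (b \<noteq> c) \<le> dec_err n F x b + dec_err n F y c"
proof -
  have "dec_err n F (xorp n x y) (b \<noteq> c)
      \<le> measure_pmf.prob (unif n) {z. dec n F x z \<noteq> b \<or> dec n F y (xorp n z x) \<noteq> c}"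
    unfolding dec_err_def by (rule prob_mono_pmf) (auto simp: dec_xorp)
  also have "\<dots> \<le> dec_err n F x b + measure_pmf.prob (unif n) {z. dec n F y (xorp n z x) \<noteq> c}"
    unfolding dec_err_def by (rule prob_disj_pmf)
  also have "measure_pmf.prob (unif n) {z. dec n F y (xorp n z x) \<noteq> c} = dec_err n F y c"
    unfolding dec_err_def by (rule prob_unif_xorp)
  finally show ?thesis .
qed

text \<open>The top element is the sum of the unit vectors, so \<open>E\<close> holds at some unit
  vector \<open>t\<close>. The meet of \<open>x\<close> with it is that vector or zero, according to
  \<open>x t\<close>, and multiplicativity reads off \<open>E x\<close>.\<close>

lemma additive_multiplicative_dictator:
  assumes add: "\<And>x y. x \<in> cube n \<Longrightarrow> y \<in> cube n \<Longrightarrow> E (xorp n x y) = (E x \<noteq> E y)"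
    and mult: "\<And>x y. x \<in> cube n \<Longrightarrow> y \<in> cube n \<Longrightarrow> E (andp n x y) = (E x \<and> E y)"
    and one: "E (onep n)"
  obtains t where "t < n" "\<And>x. x \<in> cube n \<Longrightarrow> E x = x t"
proof -
  define pre where "pre m = (\<lambda>i\<in>{..<n}. i < m)" for m :: nat
  have pre_cube: "pre m \<in> cube n" for m
    by (auto simp: in_cube_iff pre_def)
  have zero: "\<not> E (xorp n x x)" if "x \<in> cube n" for x
    using add[OF that that] by simp
  have "\<exists>t<n. E (unitp n t)"
  proof (rule ccontr)
    assume none: "\<not> (\<exists>t<n. E (unitp n t))"
    have "\<not> E (pre m)" if "m \<le> n" for m
      using that
    proof (induction m)
      case 0
      have "pre 0 = xorp n (onep n) (onep n)"
        by (rule cube_ext[where n = n]) (auto simp: pre_cube, auto simp: pre_def xorp_def)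
      then show ?case
        using zero by simp
    next
      case (Suc m)
      have "pre (Suc m) = xorp n (pre m) (unitp n m)"
        by (rule cube_ext[where n = n]) (auto simp: pre_cube, auto simp: pre_def xorp_def unitp_def)
      then show ?case
        using Suc none add[OF pre_cube unitp_in_cube, of m m] by auto
    qed
    from this[of n] have "\<not> E (pre n)"
      by simp
    moreover have "pre n = onep n"
      by (auto simp: pre_def onep_def)
    ultimately show False
      using one by simp
  qed
  then obtain t where t: "t < n" "E (unitp n t)"
    by auto
  have "E x = x t" if x: "x \<in> cube n" for x
  proof (cases "x t")
    case True
    then have "andp n x (unitp n t) = unitp n t"
      by (intro cube_ext[where n = n]) (simp_all, auto simp: andp_def unitp_def)
    then show ?thesis
      using mult[OF x unitp_in_cube[of n t]] t True by simp
  next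
    case False
    then have "andp n x (unitp n t) = xorp n x x"
      by (intro cube_ext[where n = n]) (simp_all, auto simp: andp_def unitp_def xorp_def)
    then show ?thesis
      using mult[OF x unitp_in_cube[of n t]] t False zero[OF x] by simp
  qed
  then show thesis
    using t that by blast
qed

text \<open>As in linearity testing, the reliably decoded values \<open>E\<close> obey the algebraic
  laws at every point, although the test sees average behaviour only. Rejection below
  \<open>1 / 32\<close> leaves fewer than half of all \<open>x\<close> unreliable at level
  \<open>1 / 16\<close>, which fixes the threshold; the two algebraic conditions leave more
  room.\<close>

lemma dictator_if_round_accepts:
  assumes acc: "measure_pmf.prob (dictator_round n F) {False} < 1 / 33"
  obtains t where "t < n" "\<And>x. x \<in> cube n \<Longrightarrow> dec_err n F x (x t) \<le> 1 / 8"
proof -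
  let ?U = "unif n"
  have bad: "measure_pmf.prob ?U {x. \<forall>b. dec_err n F x b > 1 / 16} < 1 / 2"
  proof -
    have "measure_pmf.prob ?U {x. \<forall>b. dec_err n F x b > 1 / 16} * (1 / 16)
        \<le> measure_pmf.prob (dictator_round n F) {False}"
      unfolding dictator_round_def
    proof (rule prob_bind_ge)
      fix x assume x: "x \<in> {x. \<forall>b. dec_err n F x b > 1 / 16}"
      show "1 / 16 \<le> measure_pmf.prob (bind_pmf ?U (\<lambda>y. bind_pmf ?U (\<lambda>z. bind_pmf ?U (\<lambda>z'.
        return_pmf (round_ok n F x y z z'))))) {False}"
      proof (rule prob_bind_ge_const; (rule prob_bind_ge_const)?)
        fix y z
        \<comment> \<open>Whatever value \<open>z\<close> yields, an independent \<open>z'\<close>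
          contradicts it with probability above \<open>1 / 16\<close>.\<close>
        have "1 / 16 \<le> dec_err n F x (dec n F x z)"
          using x by (auto intro: less_imp_le)
        also have "\<dots> \<le> measure_pmf.prob ?U {z'. round_ok n F x y z z' \<in> {False}}"
          unfolding dec_err_def by (rule prob_mono_pmf) (auto simp: round_ok_def)
        finally show "1 / 16 \<le> measure_pmf.prob (bind_pmf ?U (\<lambda>z'.
          return_pmf (round_ok n F x y z z'))) {False}"
          unfolding prob_bind_return .
      qed auto
    qed auto
    with acc show ?thesis
      by simp
  qed
  \<comment> \<open>Every \<open>x\<close> is a sum of two uniformly random points, both of which are decoded reliably for some
    choice.\<close>
  have "\<exists>b. dec_err n F x b \<le> 1 / 8" if x: "x \<in> cube n" for x
  proof -
    let ?P = "\<lambda>x. \<forall>b. dec_err n F x b > 1 / 16"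
    have "measure_pmf.prob ?U {a. ?P a \<or> ?P (xorp n a x)}
        \<le> measure_pmf.prob ?U {a. ?P a} + measure_pmf.prob ?U {a. ?P (xorp n a x)}"
      by (rule prob_disj_pmf)
    also have "\<dots> = 2 * measure_pmf.prob ?U {a. ?P a}"
      using prob_unif_xorp[of n ?P x] by simp
    also have "\<dots> < 1"
      using bad by simp
    finally have lt: "measure_pmf.prob ?U {a. ?P a \<or> ?P (xorp n a x)} < 1" .
    have "\<exists>a\<in>cube n. \<not> (?P a \<or> ?P (xorp n a x))"
    proof (rule ccontr)
      assume "\<not> ?thesis"
      then have "measure_pmf.prob ?U {a. True} \<le> measure_pmf.prob ?U {a. ?P a \<or> ?P (xorp n a x)}"
        by (intro prob_mono_pmf) auto
      with lt show False
        by simp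
    qed
    then obtain a b c where a: "a \<in> cube n" "dec_err n F a b \<le> 1 / 16" "dec_err n F (xorp n a x) c \<le> 1 / 16"
      by (auto simp: not_less)
    have "xorp n a (xorp n a x) = x"
      using a x by (metis xorp_cancel xorp_comm)
    then have "dec_err n F x (b \<noteq> c) \<le> 1 / 8"
      using dec_err_xorp[of n F a "xorp n a x" b c] a by simp
    then show ?thesis
      by blast
  qed
  then obtain E where E: "\<And>x. x \<in> cube n \<Longrightarrow> dec_err n F x (E x) \<le> 1 / 8"
    by metis
  \<comment> \<open>The errors of the two truth values add up to 1, so an error below
    \<open>7 / 8\<close> already singles out \<open>E x\<close>.\<close>
  have uniq: "b = E x" if "x \<in> cube n" "dec_err n F x b < 7 / 8" for x b
    using dec_err_neq[of b "E x" n F x] E[OF that(1)] that by (cases "b = E x") auto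
  have add: "E (xorp n x y) = (E x \<noteq> E y)" if "x \<in> cube n" "y \<in> cube n" for x y
    using dec_err_xorp[of n F x y "E x" "E y"] E[OF that(1)] E[OF that(2)]
    by (intro uniq[symmetric]) auto
  have rej_le: "measure_pmf.prob ?U {z. \<not> Q z} \<le> measure_pmf.prob (bind_pmf ?U (\<lambda>z. bind_pmf ?U (\<lambda>z'.
          return_pmf (round_ok n F x y z z')))) {False}"
    if "\<And>z. z \<in> cube n \<Longrightarrow> dec n F (andp n x y) z = (dec n F x z \<and> dec n F y z) \<Longrightarrow> dec n F (onep n) z \<Longrightarrow> Q z" for x y Q
  proof -
    have "measure_pmf.prob ?U {z. \<not> Q z} * 1 \<le> measure_pmf.prob (bind_pmf ?U (\<lambda>z. bind_pmf ?U (\<lambda>z'.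
          return_pmf (round_ok n F x y z z')))) {False}"
    proof (rule prob_bind_ge)
      fix z assume z: "z \<in> set_pmf ?U" "z \<in> {z. \<not> Q z}"
      then have "\<not> (dec n F (andp n x y) z = (dec n F x z \<and> dec n F y z) \<and> dec n F (onep n) z)"
        using that by auto
      then show "1 \<le> measure_pmf.prob (bind_pmf ?U (\<lambda>z'.
          return_pmf (round_ok n F x y z z'))) {False}"
        unfolding prob_bind_return by (auto simp: round_ok_def)
    qed auto
    then show ?thesis
      by simp
  qed
  have one: "E (onep n)"
  proof -
    have "dec_err n F (onep n) True \<le> measure_pmf.prob (dictator_round n F) {False}"
      unfolding dictator_round_def
    proof (rule prob_bind_ge_const; (rule prob_bind_ge_const)?)
      fix x y
      show "dec_err n F (onep n) True \<le> measure_pmf.prob (bind_pmf ?U (\<lambda>z. bind_pmf ?U (\<lambda>z'.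
          return_pmf (round_ok n F x y z z')))) {False}"
        unfolding dec_err_def using rej_le[where Q = "dec n F (onep n)"] by simp
    qed (auto simp: dec_err_def)
    then have "dec_err n F (onep n) True < 7 / 8"
      using acc by simp
    then show ?thesis
      using uniq[of "onep n" True] by simp
  qed
  have mult: "E (andp n x y) = (E x \<and> E y)" if "x \<in> cube n" "y \<in> cube n" for x y
  proof (rule ccontr)
    assume x0y0: "E (andp n x y) \<noteq> (E x \<and> E y)"
    define W where "W = (\<lambda>(x, y). E (andp n x y) \<noteq> (E x \<and> E y))"
    have distr: "andp n (xorp n u v) w = xorp n (andp n u w) (andp n v w)"
      "andp n w (xorp n u v) = xorp n (andp n w u) (andp n w v)" for u v w
      by (rule cube_ext[where n = n]; (intro andp_in_cube xorp_in_cube)?; auto simp: andp_def xorp_def)+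
    let ?UU = "pair_pmf ?U ?U"
    have shift: "measure_pmf.prob ?UU {p. W (xorp n (fst p) a, xorp n (snd p) b)} = measure_pmf.prob ?UU {p. W p}" for a b
    proof -
      have "map_pmf (\<lambda>(u, v). (xorp n u a, xorp n v b)) ?UU = ?UU"
        by (simp add: map_pair map_pmf_unif_bij bij_betw_xorp)
      then have "measure_pmf.prob ?UU {p. W p} = measure_pmf.prob (map_pmf (\<lambda>(u, v). (xorp n u a, xorp n v b)) ?UU) {p. W p}"
        by simp
      then show ?thesis
        by (simp add: vimage_def case_prod_beta)
    qed
    have shift0: "measure_pmf.prob ?UU {p. W (fst p, xorp n (snd p) b)} = measure_pmf.prob ?UU {p. W p}"
      "measure_pmf.prob ?UU {p. W (xorp n (fst p) a, snd p)} = measure_pmf.prob ?UU {p. W p}" for a b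
    proof -
      \<comment> \<open>\<open>o'\<close> is the zero vector: translating one component by it turns
        the two-sided shift into a one-sided one.\<close>
      define o' where "o' = xorp n (onep n) (onep n)"
      have o': "xorp n u o' = u" if "u \<in> cube n" for u
        using that unfolding o'_def by (intro cube_ext[where n = n]) (simp_all, auto simp: xorp_def)
      show "measure_pmf.prob ?UU {p. W (fst p, xorp n (snd p) b)} = measure_pmf.prob ?UU {p. W p}"
        unfolding shift[of o' b, symmetric] by (rule prob_cong_pmf) (auto simp: o')
      show "measure_pmf.prob ?UU {p. W (xorp n (fst p) a, snd p)} = measure_pmf.prob ?UU {p. W p}"
        unfolding shift[of a o', symmetric] by (rule prob_cong_pmf) (auto simp: o')
    qed
    \<comment> \<open>The defect is bilinear, so its values at the four translates of a point by \<open>x\<close> and \<open>y\<close> add up to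
      its value at \<open>(x, y)\<close>, and at least one of them is nonzero.\<close>
    have "1 = measure_pmf.prob ?UU {p. True}"
      by simp
    also have "\<dots> \<le> measure_pmf.prob ?UU {p. (W p \<or> W (xorp n (fst p) x, snd p)) \<or>
        (W (fst p, xorp n (snd p) y) \<or> W (xorp n (fst p) x, xorp n (snd p) y))}"
    proof (rule prob_mono_pmf)
      fix p assume "p \<in> set_pmf ?UU"
      then obtain u v where p: "p = (u, v)" "u \<in> cube n" "v \<in> cube n"
        by auto
      show "(W p \<or> W (xorp n (fst p) x, snd p)) \<or>
        (W (fst p, xorp n (snd p) y) \<or> W (xorp n (fst p) x, xorp n (snd p) y))"
        using x0y0 that p(2,3) unfolding p(1) by (auto simp: W_def distr add)
    qed
    also have "\<dots> \<le> measure_pmf.prob ?UU {p. W p \<or> W (xorp n (fst p) x, snd p)} +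
       measure_pmf.prob ?UU {p. W (fst p, xorp n (snd p) y) \<or> W (xorp n (fst p) x, xorp n (snd p) y)}"
      by (rule prob_disj_pmf)
    also have "\<dots> \<le> (measure_pmf.prob ?UU {p. W p} + measure_pmf.prob ?UU {p. W (xorp n (fst p) x, snd p)}) +
       (measure_pmf.prob ?UU {p. W (fst p, xorp n (snd p) y)} + measure_pmf.prob ?UU {p. W (xorp n (fst p) x, xorp n (snd p) y)})"
      by (intro add_mono prob_disj_pmf)
    finally have W: "1 / 4 \<le> measure_pmf.prob ?UU {p. W p}"
      unfolding shift shift0 by simp
    define R where "R = (\<lambda>p. bind_pmf ?U (\<lambda>z. bind_pmf ?U (\<lambda>z'.
          return_pmf (round_ok n F (fst p) (snd p) z z'))))"
    have round_eq: "dictator_round n F = bind_pmf ?UU R"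
      by (simp add: dictator_round_def pair_pmf_def R_def bind_assoc_pmf bind_return_pmf)
    \<comment> \<open>Three decodings err with total probability at most \<open>3 / 8\<close>;
      otherwise the defect is visible and the round rejects. The product
      \<open>1 / 4 * 5 / 8\<close> exceeds \<open>1 / 33\<close>.\<close>
    have "measure_pmf.prob ?UU {p. W p} * (5 / 8) \<le> measure_pmf.prob (dictator_round n F) {False}"
      unfolding round_eq
    proof (rule prob_bind_ge)
      fix p assume "p \<in> set_pmf ?UU" "p \<in> {p. W p}"
      then obtain u v where p: "p = (u, v)" "u \<in> cube n" "v \<in> cube n" "W (u, v)"
        by auto
      define Q where "Q z \<longleftrightarrow> (dec n F (andp n u v) z \<noteq> E (andp n u v) \<or> dec n F u z \<noteq> E u) \<or> dec n F v z \<noteq> E v" for z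
      have "measure_pmf.prob ?U {z. Q z} \<le> measure_pmf.prob ?U {z. dec n F (andp n u v) z \<noteq> E (andp n u v) \<or> dec n F u z \<noteq> E u} + dec_err n F v (E v)"
        unfolding Q_def dec_err_def by (rule prob_disj_pmf)
      also have "\<dots> \<le> (dec_err n F (andp n u v) (E (andp n u v)) + dec_err n F u (E u)) + dec_err n F v (E v)"
        unfolding dec_err_def by (intro add_mono prob_disj_pmf order_refl)
      also have "\<dots> \<le> 3 / 8"
        using E[of "andp n u v"] E[OF p(2)] E[OF p(3)] by simp
      finally have "5 / 8 \<le> measure_pmf.prob ?U {z. \<not> Q z}"
        by (simp add: prob_compl_pmf)
      also have "\<dots> \<le> measure_pmf.prob (R p) {False}"
        unfolding R_def p(1) fst_conv snd_conv by (rule rej_le) (use p(4) in \<open>auto simp: Q_def W_def\<close>)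
      finally show "5 / 8 \<le> measure_pmf.prob (R p) {False}" .
    qed auto
    with W acc show False
      by simp
  qed
  obtain t where t: "t < n" "\<And>x. x \<in> cube n \<Longrightarrow> E x = x t"
    using additive_multiplicative_dictator[of n E] add mult one by blast
  show thesis
  proof (rule that[OF t(1)])
    show "dec_err n F x (x t) \<le> 1 / 8" if "x \<in> cube n" for x
      using E[OF that] t(2)[OF that] by simp
  qed
qed

lemma dictator_round_accepts:
  assumes lit: "\<And>x z. x \<in> cube n \<Longrightarrow> z \<in> cube n \<Longrightarrow> dec n F x z = x t" and "t < n"
  shows "dictator_round n F = return_pmf True"
proof -
  have ok: "round_ok n F x y z z' = True" if "x \<in> cube n" "y \<in> cube n" "z \<in> cube n" "z' \<in> cube n" for x y z z'
    unfolding round_ok_def using that assms by (simp add: lit) (simp add: andp_def onep_def)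
  have "dictator_round n F = bind_pmf (unif n) (\<lambda>x. bind_pmf (unif n) (\<lambda>y. bind_pmf (unif n) (\<lambda>z.
      bind_pmf (unif n) (\<lambda>z'. return_pmf True))))"
    unfolding dictator_round_def
    by (rule bind_pmf_cong[OF refl])+ (use ok in \<open>simp only: set_unif\<close>)
  then show ?thesis
    by simp
qed

text \<open>Unanimity instead of majority: on a genuine literal all votes agree, so completeness is
  perfect, and a wrong answer needs \<open>t\<close> wrong votes. \<open>None\<close> later counts
  as evidence against \<open>f\<close>. No votes at all yield \<open>Some True\<close>, whence
  \<open>0 < t\<close> in the exact case.\<close>

definition dec1 :: "nat \<Rightarrow> nat \<Rightarrow> boolfun \<Rightarrow> point \<Rightarrow> bool option pmf" where
  "dec1 n t F x = map_pmf (\<lambda>bs.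
     if \<forall>b\<in>set bs. b then Some True else if \<forall>b\<in>set bs. \<not> b then Some False else None)
     (replicate_pmf t (map_pmf (dec n F x) (unif n)))"

lemma dec1_exact:
  assumes "\<And>z. z \<in> cube n \<Longrightarrow> dec n F x z = b" "0 < t"
  shows "dec1 n t F x = return_pmf (Some b)"
proof -
  have "map_pmf (dec n F x) (unif n) = map_pmf (\<lambda>_. b) (unif n)"
    by (rule map_pmf_cong[OF refl]) (simp add: assms(1))
  then have "map_pmf (dec n F x) (unif n) = return_pmf b"
    by simp
  moreover have "replicate_pmf t (return_pmf b) = return_pmf (replicate t b)"
    by (induction t) (simp_all add: bind_return_pmf)
  ultimately show ?thesis
    using assms(2) by (cases b) (simp_all add: dec1_def)
qed

lemma dec1_err:
  assumes "dec_err n F x b \<le> 1 / 8"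
  shows "measure_pmf.prob (dec1 n t F x) {v. v \<noteq> None \<and> v \<noteq> Some b} \<le> (1 / 8) ^ t"
proof -
  have "measure_pmf.prob (dec1 n t F x) {v. v \<noteq> None \<and> v \<noteq> Some b}
      \<le> measure_pmf.prob (replicate_pmf t (map_pmf (dec n F x) (unif n))) {bs. \<forall>c\<in>set bs. c \<noteq> b}"
    unfolding dec1_def measure_map_pmf vimage_def
    by (rule prob_mono_pmf) (cases b, auto split: if_splits)
  also have "\<dots> = dec_err n F x b ^ t"
    unfolding prob_replicate_pmf_all dec_err_def by (simp add: vimage_def)
  also have "\<dots> \<le> (1 / 8) ^ t"
    using assms by (intro power_mono) (auto simp: dec_err_def)
  finally show ?thesis .
qed

subsection \<open>Comparing functions through a set of coordinates\<close>

text \<open>The restriction of \<open>f\<close> to block \<open>fst e\<close>, with the other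
  coordinates frozen to \<open>snd e\<close>. It remains a function on the whole cube, so that the
  dictator test applies as it stands.\<close>

definition probe :: "(nat \<Rightarrow> nat) \<Rightarrow> boolfun \<Rightarrow> nat \<times> point \<Rightarrow> boolfun" where
  "probe \<beta> f e = (\<lambda>z. f (mix {i. \<beta> i = fst e} z (snd e)))"

primrec decode :: "nat \<Rightarrow> nat \<Rightarrow> (nat \<Rightarrow> nat) \<Rightarrow> boolfun \<Rightarrow> point \<Rightarrow> (nat \<times> point) list \<Rightarrow> bool list option pmf" where
  "decode n t \<beta> f x [] = return_pmf (Some [])"
| "decode n t \<beta> f x (e # st) =
     bind_pmf (dec1 n t (probe \<beta> f e) x) (\<lambda>b. map_pmf (\<lambda>bs.
       case b of None \<Rightarrow> None | Some b \<Rightarrow> map_option ((#) b) bs) (decode n t \<beta> f x st))"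

lemma decode_exact:
  assumes "\<And>e z. e \<in> set st \<Longrightarrow> z \<in> cube n \<Longrightarrow> dec n (probe \<beta> f e) x z = x (\<tau> (fst e))" and "0 < t"
  shows "decode n t \<beta> f x st = return_pmf (Some (map (\<lambda>e. x (\<tau> (fst e))) st))"
  using assms(1)
proof (induction st)
  case (Cons e st)
  have "dec1 n t (probe \<beta> f e) x = return_pmf (Some (x (\<tau> (fst e))))"
    by (rule dec1_exact) (use Cons.prems assms(2) in auto)
  then show ?case
    using Cons by (simp add: bind_return_pmf)
qed simp

text \<open>A missing answer is absorbing and is not an error here, so an error needs a wrong
  unanimous vote in some block; the bound is the union over the blocks.\<close>

lemma decode_err:
  assumes "\<And>e. e \<in> set st \<Longrightarrow> dec_err n (probe \<beta> f e) x (x (\<tau> (fst e))) \<le> 1 / 8"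
  shows "measure_pmf.prob (decode n t \<beta> f x st)
     {v. v \<noteq> None \<and> v \<noteq> Some (map (\<lambda>e. x (\<tau> (fst e))) st)} \<le> real (length st) * (1 / 8) ^ t"
  using assms
proof (induction st)
  case (Cons e st)
  let ?b = "x (\<tau> (fst e))"
  let ?B = "{v. v \<noteq> None \<and> v \<noteq> Some ?b}"
  let ?A = "{v. v \<noteq> None \<and> v \<noteq> Some (map (\<lambda>e. x (\<tau> (fst e))) (e # st))}"
  let ?D = "decode n t \<beta> f x st"
  have IH: "measure_pmf.prob ?D {v. v \<noteq> None \<and> v \<noteq> Some (map (\<lambda>e. x (\<tau> (fst e))) st)}
      \<le> real (length st) * (1 / 8) ^ t"
    using Cons by simp
  have "measure_pmf.prob (decode n t \<beta> f x (e # st)) ?A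
      \<le> measure_pmf.prob (dec1 n t (probe \<beta> f e) x) ?B + real (length st) * (1 / 8) ^ t"
    unfolding decode.simps
  proof (rule prob_bind_le)
    fix b assume "b \<notin> ?B"
    then consider "b = None" | "b = Some ?b"
      by auto
    then show "measure_pmf.prob (map_pmf (\<lambda>bs. case b of None \<Rightarrow> None | Some b \<Rightarrow> map_option ((#) b) bs) ?D) ?A
        \<le> real (length st) * (1 / 8) ^ t"
    proof cases
      case 2
      have "measure_pmf.prob (map_pmf (\<lambda>bs. case b of None \<Rightarrow> None | Some b \<Rightarrow> map_option ((#) b) bs) ?D) ?A
        = measure_pmf.prob ?D {v. v \<noteq> None \<and> v \<noteq> Some (map (\<lambda>e. x (\<tau> (fst e))) st)}"
        unfolding 2 measure_map_pmf by (rule arg_cong[where f = "measure_pmf.prob ?D"]) auto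
      then show ?thesis
        using IH by simp
    qed simp
  qed simp
  also have "\<dots> \<le> (1 / 8) ^ t + real (length st) * (1 / 8) ^ t"
    using dec1_err[of n "probe \<beta> f e" x ?b t] Cons.prems by simp
  finally show ?case
    by (simp add: algebra_simps)
qed simp

section \<open>Conditional averages and the one-sided distance \<open>miss\<close>\<close>

definition cov :: "nat \<Rightarrow> nat set \<Rightarrow> boolfun \<Rightarrow> point \<Rightarrow> real" where
  "cov n T f x = (\<Sum>y\<in>cube n. of_bool (f (mix T x y))) / card (cube n)"

text \<open>A one-sided distance that samples can test. For \<open>h = f\<close> it measures how far
  membership in \<open>sat n f\<close> is from being preserved when only the coordinates in
  \<open>T\<close> are kept.\<close>

definition miss :: "nat \<Rightarrow> nat set \<Rightarrow> boolfun \<Rightarrow> boolfun \<Rightarrow> real" where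
  "miss n T f h = measure_pmf.prob (pair_pmf (pmf_of_set (sat n f)) (unif n)) {p. \<not> h (mix T (fst p) (snd p))}"

text \<open>Exchanging the coordinates outside \<open>T\<close> is an involution on pairs of points,
  so a mix of two independent uniform points is uniform.\<close>

lemma sum_mix:
  fixes G :: "point \<Rightarrow> real"
  shows "(\<Sum>x\<in>cube n. \<Sum>y\<in>cube n. G (mix T x y)) = card (cube n) * (\<Sum>x\<in>cube n. G x)"
proof -
  let ?s = "\<lambda>(x, y). (mix T x y, mix T y x)"
  have "bij_betw ?s (cube n \<times> cube n) (cube n \<times> cube n)"
  proof (rule bij_betw_involution)
    have "mix T (mix T x y) (mix T y x) = x" for x y
      by (auto simp: mix_def)
    then show "?s (?s p) = p" for p
      by (simp add: case_prod_beta)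
  qed auto
  then have "(\<Sum>p\<in>cube n \<times> cube n. G (fst (?s p))) = (\<Sum>p\<in>cube n \<times> cube n. G (fst p))"
    by (rule sum.reindex_bij_betw)
  then show ?thesis
    by (simp add: sum.cartesian_product' sum_distrib_left)
qed

lemma card_cube_pos: "0 < real (card (cube n))"
  by (simp add: card_gt_0_iff)

text \<open>\<open>cov n T f\<close> is the conditional expectation of \<open>f\<close> given the
  coordinates in \<open>T\<close>; this is its characteristic property against functions
  \<open>\<phi>\<close> of those coordinates.\<close>

lemma sum_cov:
  assumes "\<And>x y. x \<in> cube n \<Longrightarrow> y \<in> cube n \<Longrightarrow> \<phi> (mix T x y) = \<phi> x"
  shows "(\<Sum>x\<in>cube n. cov n T f x * \<phi> x) = (\<Sum>x\<in>cube n. of_bool (f x) * \<phi> x)"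
proof -
  have "(\<Sum>x\<in>cube n. cov n T f x * \<phi> x)
      = (\<Sum>x\<in>cube n. \<Sum>y\<in>cube n. of_bool (f (mix T x y)) * \<phi> (mix T x y)) / card (cube n)"
    by (simp add: cov_def assms sum_divide_distrib sum_distrib_right cong: sum.cong)
  then show ?thesis
    unfolding sum_mix[of "\<lambda>x. of_bool (f x) * \<phi> x"] using card_cube_pos[of n] by simp
qed

lemma mix_mix [simp]: "mix T (mix T x y) z = mix T x z"
  by (auto simp: mix_def)

lemma cov_mix [simp]: "cov n T f (mix T x y) = cov n T f x"
  by (simp add: cov_def)

lemma prob_unif_sum: "measure_pmf.prob (unif n) {y. P y} = (\<Sum>y\<in>cube n. of_bool (P y)) / card (cube n)"
  by (simp add: unif_def measure_pmf_of_set Int_def Collect_conj_eq[symmetric] of_bool_def sum.If_cases)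

lemma finite_sat [simp]: "finite (sat n f)"
  by (simp add: sat_def)

lemma card_sat_sum: "real (card (sat n f)) = (\<Sum>x\<in>cube n. of_bool (f x))"
  by (simp add: sat_def of_bool_def sum.If_cases Int_def)

lemma card_sat_cov: "real (card (sat n f)) = (\<Sum>x\<in>cube n. cov n T f x)"
  using sum_cov[of n "\<lambda>_. 1" T f] by (simp add: card_sat_sum)

text \<open>The right side is an inner product of conditional expectations, hence symmetric in
  \<open>f\<close> and \<open>h\<close>. This symmetry links the two directions of
  \<open>miss\<close>.\<close>

lemma card_sat_miss:
  assumes "sat n f \<noteq> {}"
  shows "real (card (sat n f)) * (1 - miss n T f h) = (\<Sum>x\<in>cube n. cov n T f x * cov n T h x)"
proof -
  have "1 - miss n T f h = measure_pmf.prob (pair_pmf (pmf_of_set (sat n f)) (unif n)) {p. h (mix T (fst p) (snd p))}"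
    unfolding miss_def prob_compl_pmf by simp
  also have "\<dots> = (\<Sum>x\<in>sat n f. measure_pmf.prob (unif n) {y. h (mix T x y)}) / card (sat n f)"
    using assms by (simp add: pair_pmf_def map_pmf_def[symmetric] prob_bind_pmf integral_pmf_of_set vimage_def)
  also have "(\<Sum>x\<in>sat n f. measure_pmf.prob (unif n) {y. h (mix T x y)}) = (\<Sum>x\<in>cube n. of_bool (f x) * cov n T h x)"
    unfolding prob_unif_sum cov_def[symmetric] sat_def
    by (simp add: of_bool_def sum.If_cases if_distrib[of "\<lambda>c. c * _"] Int_def cong: if_cong)
  also have "\<dots> = (\<Sum>x\<in>cube n. cov n T f x * cov n T h x)"
    by (rule sum_cov[symmetric]) simp
  finally show ?thesis
    using assms by (simp add: field_simps)
qed

lemma card_sat_miss_sym: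
  assumes "sat n f \<noteq> {}" "sat n h \<noteq> {}"
  shows "real (card (sat n f)) * (1 - miss n T f h) = real (card (sat n h)) * (1 - miss n T h f)"
  using card_sat_miss[OF assms(1), of T h] card_sat_miss[OF assms(2), of T f] by (simp add: mult.commute)

lemma sat_nonempty_if_miss:
  assumes "sat n f \<noteq> {}" "miss n T f h < 1"
  shows "sat n h \<noteq> {}"
proof
  assume empty: "sat n h = {}"
  have "miss n T f h = measure_pmf.prob (pair_pmf (pmf_of_set (sat n f)) (unif n)) {p. True}"
    unfolding miss_def
  proof (rule prob_cong_pmf)
    fix p assume "p \<in> set_pmf (pair_pmf (pmf_of_set (sat n f)) (unif n))"
    then have "mix T (fst p) (snd p) \<in> cube n"
      using assms(1) by (auto simp: sat_def)
    then show "(\<not> h (mix T (fst p) (snd p))) = True"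
      using empty by (auto simp: sat_def)
  qed
  then show False
    using assms(2) by simp
qed

text \<open>The covered masses of \<open>f\<close> and \<open>h\<close> agree by symmetry. As
  \<open>h\<close> is no larger than \<open>f\<close>, its uncovered mass is at most that of
  \<open>f\<close>; as at least half of \<open>f\<close> is covered, \<open>h\<close> has at least
  half its size, which costs the factor 2.\<close>

lemma miss_swap_le:
  assumes "sat n f \<noteq> {}" "card (sat n h) \<le> card (sat n f)" "miss n T f h \<le> \<eta>" "\<eta> \<le> 1 / 2"
  shows "miss n T h f \<le> 2 * \<eta>"
proof -
  define a b where "a = real (card (sat n f))" and "b = real (card (sat n h))"
  have h: "sat n h \<noteq> {}"
    using sat_nonempty_if_miss[of n f T h] assms by simp
  have pos: "0 < a" "0 < b" "b \<le> a" "0 \<le> miss n T h f" "0 \<le> miss n T f h"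
    using assms(1,2) h by (auto simp: a_def b_def card_gt_0_iff miss_def)
  have eq: "a * (1 - miss n T f h) = b * (1 - miss n T h f)"
    using card_sat_miss_sym[OF assms(1) h] by (simp add: a_def b_def)
  have "b * miss n T h f \<le> a * miss n T f h"
    using eq pos by (simp add: algebra_simps)
  also have "\<dots> \<le> a * \<eta>"
    using assms pos by simp
  finally have 1: "b * miss n T h f \<le> a * \<eta>" .
  have "a * (1 / 2) \<le> a * (1 - miss n T f h)"
    using assms pos by (intro mult_left_mono) auto
  also have "\<dots> \<le> b"
    unfolding eq using pos by (simp add: algebra_simps)
  finally have "a \<le> 2 * b"
    by simp
  then have "a * \<eta> \<le> (2 * b) * \<eta>"
    using assms pos by (intro mult_right_mono) auto
  with 1 have "b * miss n T h f \<le> b * (2 * \<eta>)"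
    by simp
  then show ?thesis
    using pos by simp
qed

text \<open>\<open>p\<close> and \<open>s\<close> are densities on a fibre, \<open>d\<close> is the
  share of the fibre where the two functions differ. Independent draws disagree with probability
  \<open>p + s - 2 * p * s\<close>. By \<open>4 * p * s \<le> (p + s)^2\<close>, twice this is at
  least \<open>c * (2 - c)\<close> for \<open>c = p + s\<close>, hence at least the smaller of
  \<open>c\<close> and \<open>2 - c\<close>.\<close>

lemma agreement_bound:
  fixes p s d :: real
  assumes "0 \<le> p" "0 \<le> s" "p \<le> 1" "s \<le> 1" "d \<le> p + s" "d \<le> 2 - p - s"
  shows "d \<le> 2 * (p + s - 2 * p * s)"
proof -
  have "0 \<le> (p - s)\<^sup>2"
    by simp
  then have *: "2 * (p + s) - (p + s) * (p + s) \<le> 2 * (p + s - 2 * p * s)"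
    by (simp add: power2_eq_square algebra_simps)
  show ?thesis
  proof (cases "p + s \<le> 1")
    case True
    then have "(p + s) * (p + s) \<le> (p + s) * 1"
      using assms by (intro mult_left_mono) auto
    with * assms show ?thesis
      by simp
  next
    case False
    then have "0 \<le> (p + s - 1) * (2 - p - s)"
      using assms by (intro mult_nonneg_nonneg) auto
    with * assms show ?thesis
      by (simp add: algebra_simps)
  qed
qed

text \<open>On each fibre over \<open>T\<close> the true disagreement is at most twice that of
  independent draws, however the functions depend on the other coordinates. Summation gives
  \<open>2 * (a * \<eta> + b * \<eta>)\<close>, and \<open>b \<le> 2 * a\<close> leads to the factor
  6.\<close>

lemma rel_dist_le_miss:
  assumes f: "sat n f \<noteq> {}" and miss: "miss n T f h \<le> \<eta>" "miss n T h f \<le> \<eta>" "\<eta> \<le> 1 / 2"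
  shows "rel_dist n f h \<le> 6 * \<eta>"
proof -
  define a b where "a = real (card (sat n f))" and "b = real (card (sat n h))"
  let ?N = "real (card (cube n))"
  have h: "sat n h \<noteq> {}"
    using sat_nonempty_if_miss[of n f T h] assms by simp
  have pos: "0 < a" "0 < b" "0 \<le> miss n T h f" "0 \<le> miss n T f h"
    using f h by (auto simp: a_def b_def card_gt_0_iff miss_def)
  have eq: "a * (1 - miss n T f h) = b * (1 - miss n T h f)"
    using card_sat_miss_sym[OF f h] by (simp add: a_def b_def)
  have "b * (1 / 2) \<le> b * (1 - miss n T h f)"
    using miss pos by (intro mult_left_mono) auto
  also have "\<dots> \<le> a"
    unfolding eq[symmetric] using pos by (simp add: algebra_simps)
  finally have b_le: "b \<le> 2 * a"
    by simp
  have pw: "(\<Sum>y\<in>cube n. of_bool (f (mix T x y) \<noteq> h (mix T x y))) / ?N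
      \<le> 2 * (cov n T f x + cov n T h x - 2 * cov n T f x * cov n T h x)" for x
  proof (rule agreement_bound)
    show "(\<Sum>y\<in>cube n. of_bool (f (mix T x y) \<noteq> h (mix T x y))) / ?N \<le> cov n T f x + cov n T h x"
      unfolding cov_def add_divide_distrib[symmetric] sum.distrib[symmetric]
      by (intro divide_right_mono sum_mono) auto
    have "?N * 2 - (\<Sum>y\<in>cube n. of_bool (f (mix T x y))) - (\<Sum>y\<in>cube n. of_bool (h (mix T x y)))
        = (\<Sum>y\<in>cube n. 2 - of_bool (f (mix T x y)) - (of_bool (h (mix T x y)) :: real))"
      by (simp add: sum_subtractf)
    also have "\<dots> \<ge> (\<Sum>y\<in>cube n. of_bool (f (mix T x y) \<noteq> h (mix T x y)))"
      by (intro sum_mono) auto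
    finally have "(\<Sum>y\<in>cube n. of_bool (f (mix T x y) \<noteq> h (mix T x y))) / ?N \<le>
       (?N * 2 - (\<Sum>y\<in>cube n. of_bool (f (mix T x y))) - (\<Sum>y\<in>cube n. of_bool (h (mix T x y)))) / ?N"
      by (intro divide_right_mono) auto
    also have "\<dots> = 2 - cov n T f x - cov n T h x"
      using card_cube_pos[of n] by (simp add: cov_def diff_divide_distrib)
    finally show "(\<Sum>y\<in>cube n. of_bool (f (mix T x y) \<noteq> h (mix T x y))) / ?N \<le> 2 - cov n T f x - cov n T h x" .
    have "(\<Sum>y\<in>cube n. of_bool (g (mix T x y)) :: real) \<le> (\<Sum>y\<in>cube n. 1)" for g :: boolfun
      by (intro sum_mono) auto
    then show "cov n T f x \<le> 1" "cov n T h x \<le> 1"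
      using card_cube_pos[of n] by (simp_all add: cov_def)
  qed (auto simp: cov_def intro!: divide_nonneg_nonneg sum_nonneg)
  have "real (card (sym_diff (sat n f) (sat n h))) = (\<Sum>x\<in>cube n. of_bool (f x \<noteq> h x))"
  proof -
    have "sym_diff (sat n f) (sat n h) = {x \<in> cube n. f x \<noteq> h x}"
      by (auto simp: sat_def)
    then show ?thesis
      by (simp add: of_bool_def sum.If_cases Int_def)
  qed
  also have "\<dots> = (\<Sum>x\<in>cube n. (\<Sum>y\<in>cube n. of_bool (f (mix T x y) \<noteq> h (mix T x y))) / ?N)"
    using sum_mix[of "\<lambda>x. of_bool (f x \<noteq> h x)" T n] card_cube_pos[of n]
    by (simp add: sum_divide_distrib[symmetric])
  also have "\<dots> \<le> (\<Sum>x\<in>cube n. 2 * (cov n T f x + cov n T h x - 2 * cov n T f x * cov n T h x))"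
    by (intro sum_mono pw)
  also have "\<dots> = 2 * a + 2 * b - 4 * (\<Sum>x\<in>cube n. cov n T f x * cov n T h x)"
    unfolding a_def b_def card_sat_cov[of _ _ T]
    by (simp add: sum_distrib_left sum_subtractf sum.distrib algebra_simps)
  also have "\<dots> = 2 * a + 2 * b - 2 * (a * (1 - miss n T f h)) - 2 * (b * (1 - miss n T h f))"
    unfolding eq[symmetric] unfolding a_def card_sat_miss[OF f] by simp
  also have "\<dots> = 2 * (a * miss n T f h + b * miss n T h f)"
    by (simp add: algebra_simps)
  also have "\<dots> \<le> 2 * (a * \<eta> + (2 * a) * \<eta>)"
    using miss pos b_le by (intro mult_left_mono add_mono mult_mono) auto
  finally show ?thesis
    using pos by (simp add: rel_dist_def a_def field_simps)
qed

subsection \<open>Relabelling the coordinates\<close>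

text \<open>List \<open>ts\<close>, then the rest of \<open>R\<close>, then everything else.
  Soundness takes \<open>R = set ts\<close>; completeness takes all relevant variables, so that
  those in blocks never found also receive indices below \<open>card R\<close>.\<close>

lemma extend_to_permutation:
  assumes "distinct ts" "set ts \<subseteq> R" "R \<subseteq> {..<n}"
  shows "\<exists>\<pi>. \<pi> permutes {..<n} \<and> (\<forall>i<length ts. \<pi> i = ts ! i) \<and> \<pi> ` {..<card R} = R"
proof -
  have fin: "finite R"
    using assms(3) finite_subset by blast
  define us where "us = ts @ sorted_list_of_set (R - set ts)"
  define vs where "vs = us @ sorted_list_of_set ({..<n} - R)"
  have us: "distinct us" "set us = R" "length us = card R"
  proof -
    show "distinct us" "set us = R"
      using assms fin by (auto simp: us_def)
    then show "length us = card R"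
      using distinct_card[of us] by simp
  qed
  have vs: "distinct vs" "set vs = {..<n}" "length vs = n"
  proof -
    show "distinct vs" "set vs = {..<n}"
      using assms us fin by (auto simp: vs_def)
    then show "length vs = n"
      using distinct_card[of vs] by simp
  qed
  define \<pi> where "\<pi> i = (if i < n then vs ! i else i)" for i
  have le: "card R \<le> n"
    using card_mono[OF _ assms(3)] by simp
  show ?thesis
  proof (intro exI[of _ \<pi>] conjI allI impI)
    have "bij_betw (\<lambda>i. vs ! i) {..<n} {..<n}"
      by (rule bij_betw_nth) (simp_all add: vs)
    then have "bij_betw \<pi> {..<n} {..<n}"
      by (rule bij_betw_cong[THEN iffD1, rotated]) (simp add: \<pi>_def)
    then show "\<pi> permutes {..<n}"
      by (rule bij_imp_permutes) (simp add: \<pi>_def)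
    have \<pi>_us: "\<pi> i = us ! i" if "i < card R" for i
      using that le us by (simp add: \<pi>_def vs_def nth_append)
    have "length ts \<le> card R"
      using us by (simp add: us_def)
    then show "\<pi> i = ts ! i" if "i < length ts" for i
      using that \<pi>_us[of i] by (simp add: us_def nth_append)
    have "\<pi> ` {..<card R} = (\<lambda>i. us ! i) ` {..<card R}"
      by (rule image_cong) (auto simp: \<pi>_us)
    then show "\<pi> ` {..<card R} = R"
      using us nth_image[of "length us" us] by (simp add: lessThan_atLeast0)
  qed
qed

lemma relabel_in_cube:
  assumes "p permutes {..<n}" "x \<in> cube n"
  shows "(\<lambda>i. x (p i)) \<in> cube n"
  using assms by (auto simp: in_cube_iff permutes_not_in)

lemma bij_betw_relabel:
  assumes "p permutes {..<n}"
  shows "bij_betw (\<lambda>x i. x (p i)) (cube n) (cube n)"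
  by (rule bij_betw_byWitness[where f' = "\<lambda>x i. x (inv p i)"])
    (use assms in \<open>auto intro!: relabel_in_cube simp: permutes_inv permutes_inverses\<close>)

lemma bij_betw_sat_permute_vars:
  assumes "p permutes {..<n}"
  shows "bij_betw (\<lambda>v i. v (inv p i)) (sat n g) (sat n (permute_vars n p g))"
  by (rule bij_betw_byWitness[where f' = "\<lambda>x i. x (p i)"])
    (use assms in \<open>auto simp: sat_def permutes_inverses permute_vars_def relabel_in_cube permutes_inv\<close>)

lemma card_sat_permute_vars:
  "p permutes {..<n} \<Longrightarrow> card (sat n (permute_vars n p g)) = card (sat n g)"
  by (rule bij_betw_same_card[OF bij_betw_sat_permute_vars, symmetric])

lemma sat_permute_vars_empty:
  "p permutes {..<n} \<Longrightarrow> sat n (permute_vars n p g) = {} \<longleftrightarrow> sat n g = {}"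
  using card_sat_permute_vars[of p n g] by (metis card_eq_0_iff finite_sat)

lemma permute_vars_inv:
  assumes "p permutes {..<n}" "f \<in> boolfuns n"
  shows "permute_vars n p (permute_vars n (inv p) f) = f"
proof
  show "permute_vars n p (permute_vars n (inv p) f) x = f x" for x
    using assms by (cases "x \<in> cube n")
      (auto simp: permute_vars_def relabel_in_cube permutes_inverses boolfuns_def PiE_def extensional_def)
qed

lemma depends_on_permute_vars:
  assumes p: "p permutes {..<n}" and dep: "depends_on n (permute_vars n (inv p) f) i"
  shows "depends_on n f (p i)"
proof -
  from dep obtain x where x: "i < n" "x \<in> cube n"
    "permute_vars n (inv p) f x \<noteq> permute_vars n (inv p) f (x(i := \<not> x i))"
    by (auto simp: depends_on_def)
  let ?y = "\<lambda>j. x (inv p j)"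
  have y: "?y \<in> cube n"
    by (rule relabel_in_cube[OF permutes_inv[OF p] x(2)])
  have "(\<lambda>j. (x(i := \<not> x i)) (inv p j)) = ?y(p i := \<not> ?y (p i))"
  proof
    fix j
    have "inv p j = i \<longleftrightarrow> j = p i"
      using permutes_inv_eq[OF p, of j i] by metis
    then show "(x(i := \<not> x i)) (inv p j) = (?y(p i := \<not> ?y (p i))) j"
      using permutes_inverses(2)[OF p, of i] by (simp only: fun_upd_apply)
  qed
  moreover have "x(i := \<not> x i) \<in> cube n"
    using x by (auto simp: in_cube_iff)
  ultimately have "permute_vars n (inv p) f (x(i := \<not> x i)) = f (?y(p i := \<not> ?y (p i)))"
    by (simp only: permute_vars_def restrict_apply' if_True)
  moreover have "permute_vars n (inv p) f x = f ?y"
    using x(2) by (simp only: permute_vars_def restrict_apply')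
  ultimately have "f ?y \<noteq> f (?y(p i := \<not> ?y (p i)))"
    using x(3) by argo
  moreover have "p i < n"
    using permutes_in_image[OF p] x(1) by auto
  ultimately show ?thesis
    using y unfolding depends_on_def by blast
qed

text \<open>The position in \<open>st\<close> serves as the name of a variable, so the abstract
  point can be formed while the hidden coordinates stay unknown.\<close>

definition zsample :: "nat \<Rightarrow> nat \<Rightarrow> (nat \<Rightarrow> nat) \<Rightarrow> (nat \<times> point) list \<Rightarrow> boolfun \<Rightarrow> point option pmf" where
  "zsample n t \<beta> st f =
     bind_pmf (pair_pmf (pmf_of_set (sat n f)) (unif n)) (\<lambda>p.
       map_pmf (map_option (\<lambda>bs i. if i < length bs then bs ! i else snd p i)) (decode n t \<beta> f (fst p) st))"

text \<open>This writes \<open>v l\<close> into an unknown hidden variable: if the decoded bit of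
  its block is wrong, the whole block is flipped.\<close>

definition adjust :: "nat \<Rightarrow> (nat \<Rightarrow> nat) \<Rightarrow> (nat \<times> point) list \<Rightarrow> bool list \<Rightarrow> point \<Rightarrow> point \<Rightarrow> point" where
  "adjust n \<beta> st bs v y =
     (\<lambda>i. if i < n \<and> (\<exists>l<length st. fst (st ! l) = \<beta> i \<and> bs ! l \<noteq> v l) then \<not> y i else y i)"

text \<open>The candidate \<open>g\<close> is known explicitly, so drawing from
  \<open>sat n g\<close> is internal randomness. Only the decoding of the uniform point and one
  evaluation of \<open>f\<close> use the oracle.\<close>

definition check :: "nat \<Rightarrow> nat \<Rightarrow> (nat \<Rightarrow> nat) \<Rightarrow> (nat \<times> point) list \<Rightarrow> boolfun \<Rightarrow> boolfun \<Rightarrow> bool pmf" where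
  "check n t \<beta> st g f =
     bind_pmf (pair_pmf (pmf_of_set (sat n g)) (unif n)) (\<lambda>p.
       map_pmf (\<lambda>d. case d of None \<Rightarrow> False | Some bs \<Rightarrow> f (adjust n \<beta> st bs (fst p) (snd p)))
         (decode n t \<beta> f (snd p) st))"

text \<open>\<open>\<tau> j\<close> is the hidden variable of block \<open>j\<close>; the permutation \<open>\<pi>\<close> sends the \<open>i\<close>-th abstract variable to
  the hidden variable of the \<open>i\<close>-th found block.\<close>

locale labelled_blocks =
  fixes n :: nat and \<beta> :: "nat \<Rightarrow> nat" and st :: "(nat \<times> point) list"
    and \<tau> :: "nat \<Rightarrow> nat" and \<pi> :: "nat \<Rightarrow> nat"
  assumes distinct_st: "distinct (map fst st)"
    and \<tau>_less: "\<And>e. e \<in> set st \<Longrightarrow> \<tau> (fst e) < n"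
    and \<beta>_\<tau>: "\<And>e. e \<in> set st \<Longrightarrow> \<beta> (\<tau> (fst e)) = fst e"
    and perm: "\<pi> permutes {..<n}"
    and \<pi>_nth: "\<And>i. i < length st \<Longrightarrow> \<pi> i = \<tau> (fst (st ! i))"
begin

definition T :: "nat set" where
  "T = (\<lambda>e. \<tau> (fst e)) ` set st"

abbreviation bits :: "point \<Rightarrow> bool list" where
  "bits x \<equiv> map (\<lambda>e. x (\<tau> (fst e))) st"

lemma T_less: "T \<subseteq> {..<n}"
  using \<tau>_less by (auto simp: T_def)

lemma T_eq: "T = \<pi> ` {..<length st}"
  by (auto simp: T_def set_conv_nth \<pi>_nth intro!: image_eqI)

lemma \<pi>_in_T: "\<pi> i \<in> T \<longleftrightarrow> i < length st"
  unfolding T_eq using permutes_inj[OF perm] by (auto simp: inj_def)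

lemma map_unif_ideal_point:
  assumes "x \<in> cube n"
  shows "map_pmf (\<lambda>w. g (\<lambda>i. if i < length (bits x) then bits x ! i else w i)) (unif n)
    = map_pmf (\<lambda>w. permute_vars n \<pi> g (mix T x w)) (unif n)"
proof -
  let ?h = "\<lambda>w i. w (inv \<pi> i)"
  have "map_pmf (\<lambda>w. permute_vars n \<pi> g (mix T x w)) (unif n)
      = map_pmf (\<lambda>w. permute_vars n \<pi> g (mix T x w)) (map_pmf ?h (unif n))"
    using map_pmf_unif_bij[OF bij_betw_relabel[OF permutes_inv[OF perm]]] by simp
  also have "\<dots> = map_pmf (\<lambda>w. g (\<lambda>i. if i < length (bits x) then bits x ! i else w i)) (unif n)"
    unfolding map_pmf_comp
  proof (rule map_pmf_cong[OF refl])
    fix w assume "w \<in> set_pmf (unif n)"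
    then have "mix T x (?h w) \<in> cube n"
      using assms relabel_in_cube[OF permutes_inv[OF perm]] by simp
    moreover have "(\<lambda>i. mix T x (?h w) (\<pi> i)) = (\<lambda>i. if i < length (bits x) then bits x ! i else w i)"
      using perm by (auto simp: mix_def \<pi>_in_T \<pi>_nth permutes_inverses)
    ultimately show "permute_vars n \<pi> g (mix T x (?h w)) = g (\<lambda>i. if i < length (bits x) then bits x ! i else w i)"
      by (simp add: permute_vars_def)
  qed
  finally show ?thesis ..
qed

lemma prob_ideal_point:
  assumes "sat n f \<noteq> {}"
  shows "measure_pmf.prob (pair_pmf (pmf_of_set (sat n f)) (unif n))
      {p. \<not> g (\<lambda>i. if i < length (bits (fst p)) then bits (fst p) ! i else snd p i)}
    = miss n T f (permute_vars n \<pi> g)"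
proof -
  let ?P = "pmf_of_set (sat n f)"
  have pair: "measure_pmf.prob (pair_pmf ?P (unif n)) {p. \<not> Q (fst p) (snd p)}
      = measure_pmf.prob (bind_pmf ?P (\<lambda>x. map_pmf (Q x) (unif n))) {False}" for Q
    by (simp add: pair_pmf_def prob_bind_pmf map_pmf_def[symmetric] vimage_def)
  have "bind_pmf ?P (\<lambda>x. map_pmf (\<lambda>w. g (\<lambda>i. if i < length (bits x) then bits x ! i else w i)) (unif n))
     = bind_pmf ?P (\<lambda>x. map_pmf (\<lambda>w. permute_vars n \<pi> g (mix T x w)) (unif n))"
    by (intro bind_pmf_cong refl map_unif_ideal_point) (use assms in \<open>auto simp: sat_def\<close>)
  then show ?thesis
    unfolding miss_def pair[of "\<lambda>x w. permute_vars n \<pi> g (mix T x w)"]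
      pair[of "\<lambda>x w. g (\<lambda>i. if i < length (bits x) then bits x ! i else w i)"] by (rule arg_cong)
qed

text \<open>Flipping makes coordinates outside \<open>T\<close> depend on the decoded bits of
  \<open>y\<close>, yet the adjusted point is distributed as if \<open>v\<close> were planted on
  \<open>T\<close> and all other coordinates were fresh.\<close>

lemma map_unif_adjust:
  assumes v: "v \<in> cube n"
  shows "map_pmf (\<lambda>y. f (adjust n \<beta> st (bits y) v y)) (unif n)
    = map_pmf (\<lambda>y. f (mix T (\<lambda>i. v (inv \<pi> i)) y)) (unif n)"
proof -
  define flip where "flip y i \<longleftrightarrow> i < n \<and> (\<exists>l<length st. fst (st ! l) = \<beta> i \<and> bits y ! l \<noteq> v l)" for y i
  let ?adj = "\<lambda>y. adjust n \<beta> st (bits y) v y"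
  have adj: "?adj y i = (if flip y i then \<not> y i else y i)" for y i
    by (simp add: adjust_def flip_def)
  define \<Psi> where "\<Psi> y = mix T y (?adj y)" for y
  have \<Psi>_T: "\<Psi> y i = y i" if "i \<in> T" for y i
    using that by (simp add: \<Psi>_def mix_def)
  have bits_\<Psi>: "bits (\<Psi> y) = bits y" for y
    by (rule map_cong) (auto simp: \<Psi>_T T_def)
  have flip_\<Psi>: "flip (\<Psi> y) i = flip y i" for y i
    unfolding flip_def bits_\<Psi> ..
  \<comment> \<open>Adjusting \<open>y\<close> loses its values on \<open>T\<close>; putting them back yields an involution, which preserves the
    uniform distribution.\<close>
  have bij: "bij_betw \<Psi> (cube n) (cube n)"
  proof (rule bij_betw_involution)
    fix y assume y: "y \<in> cube n"
    have "?adj y \<in> cube n"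
      using y by (auto simp: in_cube_iff adj flip_def)
    then show "\<Psi> y \<in> cube n"
      using y by (simp add: \<Psi>_def)
    show "\<Psi> (\<Psi> y) = y"
    proof
      fix i
      show "\<Psi> (\<Psi> y) i = y i"
      proof (cases "i \<in> T")
        case False
        then have "\<Psi> z i = (if flip z i then \<not> z i else z i)" for z
          by (simp add: \<Psi>_def mix_def adj)
        then show ?thesis
          by (simp add: flip_\<Psi>)
      qed (simp add: \<Psi>_T)
    qed
  qed
  have "?adj y = mix T (\<lambda>i. v (inv \<pi> i)) (\<Psi> y)" for y
  proof
    fix i
    show "?adj y i = mix T (\<lambda>i. v (inv \<pi> i)) (\<Psi> y) i"
    proof (cases "i \<in> T")
      case True
      then obtain l where l: "l < length st" "i = \<pi> l"
        unfolding T_eq by auto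
      then have i: "i = \<tau> (fst (st ! l))" "\<beta> i = fst (st ! l)" "i < n"
        using \<pi>_nth[of l] \<beta>_\<tau>[of "st ! l"] \<tau>_less[of "st ! l"] by auto
      have "l' = l" if "l' < length st" "fst (st ! l') = fst (st ! l)" for l'
        using distinct_st that l nth_eq_iff_index_eq[of "map fst st" l' l] by simp
      then have "flip y i \<longleftrightarrow> y i \<noteq> v l"
        unfolding flip_def i(2) using i l by auto
      then show ?thesis
        using True l(2) perm by (auto simp: adj mix_def permutes_inverses)
    next
      case False
      then show ?thesis
        by (simp add: mix_def \<Psi>_def)
    qed
  qed
  then have "map_pmf (\<lambda>y. f (?adj y)) (unif n) = map_pmf (\<lambda>y. f (mix T (\<lambda>i. v (inv \<pi> i)) y)) (map_pmf \<Psi> (unif n))"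
    by (simp add: map_pmf_comp)
  then show ?thesis
    unfolding map_pmf_unif_bij[OF bij] .
qed

lemma prob_adjust:
  assumes "sat n g \<noteq> {}"
  shows "measure_pmf.prob (pair_pmf (pmf_of_set (sat n g)) (unif n))
      {p. \<not> f (adjust n \<beta> st (bits (snd p)) (fst p) (snd p))}
    = miss n T (permute_vars n \<pi> g) f"
proof -
  have pair: "measure_pmf.prob (pair_pmf P (unif n)) {p. \<not> Q (fst p) (snd p)}
      = measure_pmf.prob (bind_pmf P (\<lambda>x. map_pmf (Q x) (unif n))) {False}" for P Q
    by (simp add: pair_pmf_def prob_bind_pmf map_pmf_def[symmetric] vimage_def)
  have "map_pmf (\<lambda>v i. v (inv \<pi> i)) (pmf_of_set (sat n g)) = pmf_of_set (sat n (permute_vars n \<pi> g))"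
    using bij_betw_sat_permute_vars[OF perm] assms by (rule map_pmf_of_set_bij_betw) simp
  from this[symmetric] have "bind_pmf (pmf_of_set (sat n (permute_vars n \<pi> g))) (\<lambda>x. map_pmf (\<lambda>y. f (mix T x y)) (unif n))
     = bind_pmf (pmf_of_set (sat n g)) (\<lambda>v. map_pmf (\<lambda>y. f (mix T (\<lambda>i. v (inv \<pi> i)) y)) (unif n))"
    by (simp only: bind_map_pmf)
  also have "\<dots> = bind_pmf (pmf_of_set (sat n g)) (\<lambda>v. map_pmf (\<lambda>y. f (adjust n \<beta> st (bits y) v y)) (unif n))"
    by (intro bind_pmf_cong refl map_unif_adjust[symmetric]) (use assms in \<open>auto simp: sat_def\<close>)
  finally show ?thesis
    unfolding miss_def pair[of _ "\<lambda>x y. f (mix T x y)"]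
      pair[of _ "\<lambda>x y. f (adjust n \<beta> st (bits y) x y)"] by (rule arg_cong[OF sym])
qed

text \<open>\<open>None\<close> is consistent with no candidate, so only a wrong decoding, never a
  missing one, adds to the ideal probability.\<close>

lemma zsample_consistent_le:
  assumes lit: "\<And>e x. e \<in> set st \<Longrightarrow> x \<in> cube n \<Longrightarrow> dec_err n (probe \<beta> f e) x (x (\<tau> (fst e))) \<le> 1 / 8"
    and f: "sat n f \<noteq> {}"
  shows "measure_pmf.prob (zsample n t \<beta> st f) {v. \<exists>z. v = Some z \<and> g z}
    \<le> 1 - miss n T f (permute_vars n \<pi> g) + real (length st) * (1 / 8) ^ t"
proof -
  let ?z = "\<lambda>p i. if i < length (bits (fst p)) then bits (fst p) ! i else snd p i"
  have "measure_pmf.prob (zsample n t \<beta> st f) {v. \<exists>z. v = Some z \<and> g z}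
    \<le> measure_pmf.prob (pair_pmf (pmf_of_set (sat n f)) (unif n)) {p. g (?z p)} + real (length st) * (1 / 8) ^ t"
    unfolding zsample_def
  proof (rule prob_bind_le)
    fix p assume p: "p \<in> set_pmf (pair_pmf (pmf_of_set (sat n f)) (unif n))" "p \<notin> {p. g (?z p)}"
    have "measure_pmf.prob (map_pmf (map_option (\<lambda>bs i. if i < length bs then bs ! i else snd p i))
        (decode n t \<beta> f (fst p) st)) {v. \<exists>z. v = Some z \<and> g z}
      \<le> measure_pmf.prob (decode n t \<beta> f (fst p) st) {v. v \<noteq> None \<and> v \<noteq> Some (bits (fst p))}"
      unfolding measure_map_pmf vimage_def by (rule prob_mono_pmf) (use p(2) in auto)
    also have "\<dots> \<le> real (length st) * (1 / 8) ^ t"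
      using p(1) f lit by (intro decode_err) (auto simp: sat_def)
    finally show "measure_pmf.prob (map_pmf (map_option (\<lambda>bs i. if i < length bs then bs ! i else snd p i))
        (decode n t \<beta> f (fst p) st)) {v. \<exists>z. v = Some z \<and> g z} \<le> real (length st) * (1 / 8) ^ t" .
  qed simp
  also have "measure_pmf.prob (pair_pmf (pmf_of_set (sat n f)) (unif n)) {p. g (?z p)} = 1 - miss n T f (permute_vars n \<pi> g)"
    using prob_ideal_point[OF f, of g] by (simp only: prob_compl_pmf)
  finally show ?thesis .
qed

lemma zsample_inconsistent_eq:
  assumes lit: "\<And>e x z. e \<in> set st \<Longrightarrow> x \<in> cube n \<Longrightarrow> z \<in> cube n \<Longrightarrow> dec n (probe \<beta> f e) x z = x (\<tau> (fst e))"
    and f: "sat n f \<noteq> {}" and "0 < t"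
  shows "measure_pmf.prob (zsample n t \<beta> st f) {v. \<not> (\<exists>z. v = Some z \<and> g z)}
    = miss n T f (permute_vars n \<pi> g)"
proof -
  let ?z = "\<lambda>p i. if i < length (bits (fst p)) then bits (fst p) ! i else snd p i"
  have "zsample n t \<beta> st f = bind_pmf (pair_pmf (pmf_of_set (sat n f)) (unif n)) (\<lambda>p. return_pmf (Some (?z p)))"
    unfolding zsample_def
  proof (rule bind_pmf_cong[OF refl])
    fix p assume "p \<in> set_pmf (pair_pmf (pmf_of_set (sat n f)) (unif n))"
    then have "decode n t \<beta> f (fst p) st = return_pmf (Some (bits (fst p)))"
      using lit f \<open>0 < t\<close> by (intro decode_exact) (auto simp: sat_def)
    then show "map_pmf (map_option (\<lambda>bs i. if i < length bs then bs ! i else snd p i))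
        (decode n t \<beta> f (fst p) st) = return_pmf (Some (?z p))"
      by simp
  qed
  then show ?thesis
    using prob_ideal_point[OF f, of g] by (simp add: prob_bind_return)
qed

lemma check_accepts_le:
  assumes lit: "\<And>e x. e \<in> set st \<Longrightarrow> x \<in> cube n \<Longrightarrow> dec_err n (probe \<beta> f e) x (x (\<tau> (fst e))) \<le> 1 / 8"
    and g: "sat n g \<noteq> {}"
  shows "measure_pmf.prob (check n t \<beta> st g f) {b. b}
    \<le> 1 - miss n T (permute_vars n \<pi> g) f + real (length st) * (1 / 8) ^ t"
proof -
  let ?a = "\<lambda>p. adjust n \<beta> st (bits (snd p)) (fst p) (snd p)"
  have "measure_pmf.prob (check n t \<beta> st g f) {b. b}
    \<le> measure_pmf.prob (pair_pmf (pmf_of_set (sat n g)) (unif n)) {p. f (?a p)} + real (length st) * (1 / 8) ^ t"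
    unfolding check_def
  proof (rule prob_bind_le)
    fix p assume p: "p \<in> set_pmf (pair_pmf (pmf_of_set (sat n g)) (unif n))" "p \<notin> {p. f (?a p)}"
    have "measure_pmf.prob (map_pmf (\<lambda>d. case d of None \<Rightarrow> False | Some bs \<Rightarrow> f (adjust n \<beta> st bs (fst p) (snd p)))
         (decode n t \<beta> f (snd p) st)) {b. b}
      \<le> measure_pmf.prob (decode n t \<beta> f (snd p) st) {v. v \<noteq> None \<and> v \<noteq> Some (bits (snd p))}"
      unfolding measure_map_pmf vimage_def by (rule prob_mono_pmf) (use p(2) in \<open>auto split: option.splits\<close>)
    also have "\<dots> \<le> real (length st) * (1 / 8) ^ t"
      using p(1) g lit by (intro decode_err) (auto simp: sat_def)
    finally show "measure_pmf.prob (map_pmf (\<lambda>d. case d of None \<Rightarrow> False | Some bs \<Rightarrow> f (adjust n \<beta> st bs (fst p) (snd p)))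
         (decode n t \<beta> f (snd p) st)) {b. b} \<le> real (length st) * (1 / 8) ^ t" .
  qed simp
  also have "measure_pmf.prob (pair_pmf (pmf_of_set (sat n g)) (unif n)) {p. f (?a p)} = 1 - miss n T (permute_vars n \<pi> g) f"
    using prob_adjust[OF g, of f] by (simp only: prob_compl_pmf)
  finally show ?thesis .
qed

lemma check_rejects_eq:
  assumes lit: "\<And>e x z. e \<in> set st \<Longrightarrow> x \<in> cube n \<Longrightarrow> z \<in> cube n \<Longrightarrow> dec n (probe \<beta> f e) x z = x (\<tau> (fst e))"
    and g: "sat n g \<noteq> {}" and "0 < t"
  shows "measure_pmf.prob (check n t \<beta> st g f) {b. \<not> b} = miss n T (permute_vars n \<pi> g) f"
proof -
  let ?a = "\<lambda>p. adjust n \<beta> st (bits (snd p)) (fst p) (snd p)"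
  have "check n t \<beta> st g f = bind_pmf (pair_pmf (pmf_of_set (sat n g)) (unif n)) (\<lambda>p. return_pmf (f (?a p)))"
    unfolding check_def
  proof (rule bind_pmf_cong[OF refl])
    fix p assume "p \<in> set_pmf (pair_pmf (pmf_of_set (sat n g)) (unif n))"
    then have "decode n t \<beta> f (snd p) st = return_pmf (Some (bits (snd p)))"
      using lit g \<open>0 < t\<close> by (intro decode_exact) (auto simp: sat_def)
    then show "map_pmf (\<lambda>d. case d of None \<Rightarrow> False | Some bs \<Rightarrow> f (adjust n \<beta> st bs (fst p) (snd p)))
         (decode n t \<beta> f (snd p) st) = return_pmf (f (?a p))"
      by simp
  qed
  then show ?thesis
    using prob_adjust[OF g, of f] by (simp add: prob_bind_return)
qed

end

subsection \<open>Finding the relevant blocks\<close>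

text \<open>A hybrid argument: coordinates are exchanged one at a time, and each exchange either
  concerns an irrelevant coordinate or changes nothing.\<close>

lemma eq_if_agree_on_relevant:
  assumes x: "x \<in> cube n" and y: "y \<in> cube n"
    and agree: "\<And>i. depends_on n f i \<Longrightarrow> x i = y i"
  shows "f x = f y"
proof -
  define h where "h m = mix {..<m} y x" for m
  have "f (h m) = f x" if "m \<le> n" for m
    using that
  proof (induction m)
    case 0
    then show ?case
      by (simp add: h_def mix_def)
  next
    case (Suc m)
    have h_cube: "h m \<in> cube n"
      using x y by (simp add: h_def)
    have "f (h (Suc m)) = f (h m)"
    proof (cases "x m = y m")
      case True
      then have "h (Suc m) = h m"
        by (auto simp: h_def mix_def less_Suc_eq)
      then show ?thesis
        by simp
    next
      case False
      then have "h (Suc m) = (h m)(m := \<not> h m m)"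
        by (auto simp: h_def mix_def less_Suc_eq)
      moreover have "\<not> depends_on n f m"
        using agree False by blast
      ultimately show ?thesis
        using h_cube Suc.prems by (auto simp: depends_on_def)
    qed
    then show ?case
      using Suc by simp
  qed
  from this[of n] have "f (h n) = f x"
    by simp
  moreover have "h n = y"
    by (rule cube_ext[where n = n]) (use x y in \<open>simp_all add: h_def\<close>, simp add: mix_def)
  ultimately show ?thesis
    by simp
qed

primrec bsearch :: "(nat \<Rightarrow> bool) \<Rightarrow> nat \<Rightarrow> nat \<Rightarrow> nat" where
  "bsearch P lo 0 = lo"
| "bsearch P lo (Suc s) = (if P (lo + 2 ^ s) then bsearch P (lo + 2 ^ s) s else bsearch P lo s)"

text \<open>\<open>P\<close> may go up and down along the hybrids. The invariant that it holds at
  the lower end and fails at the upper end survives halving and leaves a drop between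
  neighbours.\<close>

lemma bsearch:
  "P lo \<Longrightarrow> \<not> P (lo + 2 ^ s) \<Longrightarrow> P (bsearch P lo s) \<and> \<not> P (Suc (bsearch P lo s))"
proof (induction s arbitrary: lo)
  case (Suc s)
  then show ?case
    by (cases "P (lo + 2 ^ s)") (simp_all add: add.assoc mult_2)
qed simp

lemma computes_bsearch: "computes n (\<lambda>f. return_pmf (bsearch (\<lambda>j. f (h j)) lo s)) s"
proof (induction s arbitrary: lo)
  case (Suc s)
  have "computes n (\<lambda>f. bind_pmf (return_pmf (f (h (lo + 2 ^ s))))
      (\<lambda>b. return_pmf (bsearch (\<lambda>j. f (h j)) (if b then lo + 2 ^ s else lo) s))) (1 + s)"
    by (rule computes_bind[OF computes_query Suc])
  then show ?case
    by (simp add: bind_return_pmf if_distrib[of "\<lambda>l. bsearch _ l s"] cong: if_cong)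
qed (simp add: computes_return)

text \<open>Blocks outside \<open>S\<close> pass from the first point to the second in the order of
  their numbers. Raising \<open>j\<close> by one can change block \<open>j\<close> only, so a drop
  of the value exposes that block.\<close>

definition hybrid :: "(nat \<Rightarrow> nat) \<Rightarrow> nat set \<Rightarrow> point \<times> point \<Rightarrow> nat \<Rightarrow> point" where
  "hybrid \<beta> S p j = mix {i. \<beta> i \<in> S \<or> j \<le> \<beta> i} (fst p) (snd p)"

definition locate :: "nat \<Rightarrow> (nat \<Rightarrow> nat) \<Rightarrow> nat set \<Rightarrow> point \<times> point \<Rightarrow> boolfun \<Rightarrow> nat \<times> point" where
  "locate s \<beta> S p f = (let j = bsearch (\<lambda>j. f (hybrid \<beta> S p j)) 0 s in (j, hybrid \<beta> S p j))"

definition trial :: "nat \<Rightarrow> (nat \<Rightarrow> nat) \<Rightarrow> nat set \<Rightarrow> boolfun \<Rightarrow> (point \<times> point) option pmf" where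
  "trial n \<beta> S f = bind_pmf (pair_pmf (pmf_of_set (sat n f)) (unif n)) (\<lambda>p.
     return_pmf (if f (mix {i. \<beta> i \<in> S} (fst p) (snd p)) then None else Some p))"

definition phase :: "nat \<Rightarrow> nat \<Rightarrow> nat \<Rightarrow> (nat \<Rightarrow> nat) \<Rightarrow> nat set \<Rightarrow> boolfun \<Rightarrow> (nat \<times> point) option pmf" where
  "phase n s M \<beta> S f = bind_pmf (replicate_pmf M (trial n \<beta> S f)) (\<lambda>os.
     case List.find (\<lambda>o'. o' \<noteq> None) os of
       None \<Rightarrow> return_pmf None
     | Some o' \<Rightarrow> return_pmf (Some (locate s \<beta> S (the o') f)))"

text \<open>With \<open>p = k + 1\<close> rounds from the empty list, the search on a satisfiable
  \<open>k\<close>-junta always ends with a round that finds nothing.\<close>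

primrec search :: "nat \<Rightarrow> nat \<Rightarrow> nat \<Rightarrow> (nat \<Rightarrow> nat) \<Rightarrow> nat \<Rightarrow> (nat \<times> point) list \<Rightarrow> boolfun \<Rightarrow> (nat \<times> point) list pmf" where
  "search n s M \<beta> 0 st f = return_pmf st"
| "search n s M \<beta> (Suc p) st f = bind_pmf (phase n s M \<beta> (fst ` set st) f) (\<lambda>r.
     case r of None \<Rightarrow> return_pmf st | Some e \<Rightarrow> search n s M \<beta> p (e # st) f)"

definition witnessed :: "nat \<Rightarrow> (nat \<Rightarrow> nat) \<Rightarrow> boolfun \<Rightarrow> nat \<times> point \<Rightarrow> bool" where
  "witnessed n \<beta> f e \<longleftrightarrow> snd e \<in> cube n \<and>
     (\<exists>z\<in>cube n. \<exists>z'\<in>cube n. probe \<beta> f e z \<noteq> probe \<beta> f e z')"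

definition valid_blocks :: "nat \<Rightarrow> (nat \<Rightarrow> nat) \<Rightarrow> boolfun \<Rightarrow> (nat \<times> point) list \<Rightarrow> bool" where
  "valid_blocks n \<beta> f st \<longleftrightarrow> distinct (map fst st) \<and> (\<forall>e\<in>set st. witnessed n \<beta> f e)"

text \<open>The hybrids at \<open>j\<close> and \<open>Suc j\<close> have different values but agree
  outside block \<open>j\<close>, so the first one is a background on which the probe is not
  constant. For a block in \<open>S\<close> they would coincide.\<close>

lemma locate_witnessed:
  assumes x: "fst p \<in> cube n" "f (fst p)" and y: "snd p \<in> cube n"
    and rej: "\<not> f (mix {i. \<beta> i \<in> S} (fst p) (snd p))"
    and \<beta>: "\<And>i. i < n \<Longrightarrow> \<beta> i < 2 ^ s"
  shows "witnessed n \<beta> f (locate s \<beta> S p f)" "fst (locate s \<beta> S p f) \<notin> S"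
proof -
  let ?h = "hybrid \<beta> S p"
  define j where "j = bsearch (\<lambda>j. f (?h j)) 0 s"
  have h_cube: "?h j \<in> cube n" for j
    using x y by (simp add: hybrid_def)
  have "?h 0 = fst p"
    by (auto simp: hybrid_def mix_def)
  moreover have "?h (0 + 2 ^ s) = mix {i. \<beta> i \<in> S} (fst p) (snd p)"
  proof (rule cube_ext[OF h_cube])
    show "?h (0 + 2 ^ s) i = mix {i. \<beta> i \<in> S} (fst p) (snd p) i" if "i < n" for i
      using \<beta>[OF that] by (auto simp: hybrid_def mix_def)
  qed (use x y in simp)
  ultimately have j: "f (?h j)" "\<not> f (?h (Suc j))"
    using bsearch[of "\<lambda>j. f (?h j)" 0 s] x rej by (simp_all add: j_def)
  have loc: "locate s \<beta> S p f = (j, ?h j)"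
    by (simp add: locate_def j_def Let_def)
  have "mix {i. \<beta> i = j} (?h j) (?h j) = ?h j"
    by (auto simp: mix_def)
  moreover have "mix {i. \<beta> i = j} (?h (Suc j)) (?h j) = ?h (Suc j)"
  proof
    fix i
    have "j \<le> \<beta> i \<longleftrightarrow> Suc j \<le> \<beta> i" if "\<beta> i \<noteq> j"
      using that by auto
    then show "mix {i. \<beta> i = j} (?h (Suc j)) (?h j) i = ?h (Suc j) i"
      by (simp add: mix_def hybrid_def)
  qed
  ultimately have "probe \<beta> f (j, ?h j) (?h j) \<noteq> probe \<beta> f (j, ?h j) (?h (Suc j))"
    using j by (simp add: probe_def)
  then show "witnessed n \<beta> f (locate s \<beta> S p f)"
    unfolding loc witnessed_def using h_cube by auto
  show "fst (locate s \<beta> S p f) \<notin> S"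
  proof
    assume "fst (locate s \<beta> S p f) \<in> S"
    then have "\<beta> i \<in> S \<or> j \<le> \<beta> i \<longleftrightarrow> \<beta> i \<in> S \<or> Suc j \<le> \<beta> i" for i
      by (cases "\<beta> i = j") (auto simp: loc)
    then have "?h j = ?h (Suc j)"
      by (simp add: hybrid_def)
    then show False
      using j by simp
  qed
qed

lemma set_phase:
  assumes "Some e \<in> set_pmf (phase n s M \<beta> S f)" and "sat n f \<noteq> {}"
    and "\<And>i. i < n \<Longrightarrow> \<beta> i < 2 ^ s"
  shows "witnessed n \<beta> f e" "fst e \<notin> S"
proof -
  from assms(1) obtain os o' where os: "os \<in> set_pmf (replicate_pmf M (trial n \<beta> S f))"
    "List.find (\<lambda>o'. o' \<noteq> None) os = Some o'" "e = locate s \<beta> S (the o') f"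
    unfolding phase_def by (auto split: option.splits)
  then have "o' \<in> set os" "o' \<noteq> None"
    by (auto simp: find_Some_iff in_set_conv_nth)
  then have "o' \<in> set_pmf (trial n \<beta> S f)" "o' \<noteq> None"
    using os(1) by (auto simp: set_replicate_pmf)
  then obtain p where p: "o' = Some p" "fst p \<in> sat n f" "snd p \<in> cube n"
    "\<not> f (mix {i. \<beta> i \<in> S} (fst p) (snd p))"
    using assms(2) by (auto simp: trial_def split: if_splits)
  then show "witnessed n \<beta> f e" "fst e \<notin> S"
    using locate_witnessed[of p n f \<beta> S s] assms(3) os(3) by (auto simp: sat_def)
qed

lemma prob_phase_None:
  "measure_pmf.prob (phase n s M \<beta> S f) {None} = (1 - miss n {i. \<beta> i \<in> S} f f) ^ M"
proof -
  have "measure_pmf.prob (phase n s M \<beta> S f) {None}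
    = measure_pmf.prob (bind_pmf (replicate_pmf M (trial n \<beta> S f)) (\<lambda>os. return_pmf (\<forall>o'\<in>set os. o' = None))) {True}"
    unfolding phase_def prob_bind_pmf
  proof (rule Bochner_Integration.integral_cong[OF refl])
    fix os
    show "measure_pmf.prob (case List.find (\<lambda>o'. o' \<noteq> None) os of None \<Rightarrow> return_pmf None
        | Some o' \<Rightarrow> return_pmf (Some (locate s \<beta> S (the o') f))) {None}
      = measure_pmf.prob (return_pmf (\<forall>o'\<in>set os. o' = None)) {True}"
    proof (cases "List.find (\<lambda>o'. o' \<noteq> None) os")
      case None
      then have "\<forall>o'\<in>set os. o' = None"
        unfolding find_None_iff by blast
      then show ?thesis
        using None by simp
    next
      case (Some o')
      then have "\<exists>o'\<in>set os. o' \<noteq> None"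
        unfolding find_Some_iff using nth_mem by blast
      then show ?thesis
        using Some by (auto simp: indicator_def)
    qed
  qed
  also have "\<dots> = measure_pmf.prob (trial n \<beta> S f) {o'. o' = None} ^ M"
    by (simp add: prob_bind_return prob_replicate_pmf_all)
  also have "measure_pmf.prob (trial n \<beta> S f) {o'. o' = None}
    = measure_pmf.prob (pair_pmf (pmf_of_set (sat n f)) (unif n)) {p. f (mix {i. \<beta> i \<in> S} (fst p) (snd p))}"
    unfolding trial_def prob_bind_return by (rule arg_cong[where f = "measure_pmf.prob _"]) auto
  also have "\<dots> = 1 - miss n {i. \<beta> i \<in> S} f f"
    by (simp add: miss_def prob_compl_pmf)
  finally show ?thesis .
qed

section \<open>The search on a junta\<close>

lemma finite_depends_on: "finite {i. depends_on n f i}"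
  by (rule finite_subset[of _ "{..<n}"]) (auto simp: depends_on_def)

lemma witnessed_relevant:
  assumes "witnessed n \<beta> f e"
  obtains i where "depends_on n f i" "\<beta> i = fst e"
proof -
  from assms obtain z z' where z: "snd e \<in> cube n" "z \<in> cube n" "z' \<in> cube n"
    "probe \<beta> f e z \<noteq> probe \<beta> f e z'"
    by (auto simp: witnessed_def)
  have "\<exists>i. depends_on n f i \<and> \<beta> i = fst e"
  proof (rule ccontr)
    assume none: "\<not> ?thesis"
    have "f (mix {i. \<beta> i = fst e} z (snd e)) = f (mix {i. \<beta> i = fst e} z' (snd e))"
      by (rule eq_if_agree_on_relevant[where n = n and f = f]) (use z none in \<open>simp_all\<close>, auto simp: mix_def)
    then show False
      using z by (simp add: probe_def)
  qed
  then show thesis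
    using that by blast
qed

text \<open>Each witnessed block contains a relevant variable, and distinct blocks contain distinct
  ones.\<close>

lemma length_valid_blocks:
  assumes "valid_blocks n \<beta> f st" "is_junta n k f"
  shows "length st \<le> k"
proof -
  have "fst ` set st \<subseteq> \<beta> ` {i. depends_on n f i}"
    using assms(1) by (force simp: valid_blocks_def elim: witnessed_relevant)
  then have "card (fst ` set st) \<le> card (\<beta> ` {i. depends_on n f i})"
    by (intro card_mono finite_imageI finite_depends_on)
  also have "\<dots> \<le> card {i. depends_on n f i}"
    by (rule card_image_le[OF finite_depends_on])
  also have "card (fst ` set st) = length st"
    using assms(1) distinct_card[of "map fst st"] by (simp add: valid_blocks_def)
  finally show ?thesis
    using assms(2) by (simp add: is_junta_def)
qed

text \<open>A round goes wrong only if all its \<open>M\<close> trials fail while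
  \<open>miss\<close> still exceeds \<open>\<delta>\<close>; a union bound covers the rounds. The
  invariant \<open>k < length st + p\<close> excludes running out of rounds, as valid lists have
  length at most \<open>k\<close>.\<close>

lemma prob_search_bad:
  assumes junta: "is_junta n k f" and f: "sat n f \<noteq> {}" and \<beta>: "\<And>i. i < n \<Longrightarrow> \<beta> i < 2 ^ s"
    and \<delta>: "0 \<le> \<delta>" "\<delta> \<le> 1"
    and "valid_blocks n \<beta> f st" "k < length st + p"
  shows "measure_pmf.prob (search n s M \<beta> p st f)
    {st. \<not> (valid_blocks n \<beta> f st \<and> miss n {i. \<beta> i \<in> fst ` set st} f f \<le> \<delta>)} \<le> real p * (1 - \<delta>) ^ M"
  using assms(6,7)
proof (induction p arbitrary: st)
  case 0
  then show ?case
    using length_valid_blocks[OF _ junta] by fastforce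
next
  case (Suc p)
  let ?bad = "{st. \<not> (valid_blocks n \<beta> f st \<and> miss n {i. \<beta> i \<in> fst ` set st} f f \<le> \<delta>)}"
  let ?ph = "phase n s M \<beta> (fst ` set st) f"
  let ?K = "\<lambda>r. case r of None \<Rightarrow> return_pmf st | Some e \<Rightarrow> search n s M \<beta> p (e # st) f"
  have nonneg: "0 \<le> real p * (1 - \<delta>) ^ M" "0 \<le> (1 - \<delta>) ^ M"
    using \<delta> by auto
  have step: "measure_pmf.prob (search n s M \<beta> p (e # st) f) ?bad \<le> real p * (1 - \<delta>) ^ M"
    if "Some e \<in> set_pmf ?ph" for e
  proof (rule Suc.IH)
    show "valid_blocks n \<beta> f (e # st)"
      using Suc.prems set_phase[OF that f \<beta>] by (auto simp: valid_blocks_def)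
  qed (use Suc.prems in simp)
  show ?case
  proof (cases "miss n {i. \<beta> i \<in> fst ` set st} f f \<le> \<delta>")
    case True
    have "measure_pmf.prob (bind_pmf ?ph ?K) ?bad \<le> real p * (1 - \<delta>) ^ M"
    proof (rule prob_bind_le_const)
      fix r assume "r \<in> set_pmf ?ph"
      then show "measure_pmf.prob (?K r) ?bad \<le> real p * (1 - \<delta>) ^ M"
        using step True Suc.prems(1) nonneg by (cases r) auto
    qed (use nonneg in simp)
    then show ?thesis
      using nonneg by (simp add: algebra_simps)
  next
    case False
    have "measure_pmf.prob (bind_pmf ?ph ?K) ?bad \<le> measure_pmf.prob ?ph {None} + real p * (1 - \<delta>) ^ M"
    proof (rule prob_bind_le)
      fix r assume "r \<in> set_pmf ?ph" "r \<notin> {None}"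
      then show "measure_pmf.prob (?K r) ?bad \<le> real p * (1 - \<delta>) ^ M"
        using step by (cases r) auto
    qed (use nonneg in simp)
    also have "measure_pmf.prob ?ph {None} \<le> (1 - \<delta>) ^ M"
      unfolding prob_phase_None using False by (intro power_mono) (auto simp: miss_def)
    finally show ?thesis
      by (simp add: algebra_simps)
  qed
qed

text \<open>With one relevant variable \<open>i\<close> in its block the probe depends on
  \<open>z i\<close> alone, and the witness makes it nonconstant. It is therefore a literal, whose
  derivative in direction \<open>x\<close> is \<open>x i\<close>.\<close>

lemma isolated_probe:
  assumes wit: "witnessed n \<beta> f e" and inj: "inj_on \<beta> {i. depends_on n f i}"
    and i: "depends_on n f i" "\<beta> i = fst e" and x: "x \<in> cube n" "z \<in> cube n"
  shows "dec n (probe \<beta> f e) x z = x i"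
proof -
  let ?F = "probe \<beta> f e"
  have e: "snd e \<in> cube n"
    using wit by (simp add: witnessed_def)
  have same: "?F u = ?F v" if "u \<in> cube n" "v \<in> cube n" "u i = v i" for u v
    unfolding probe_def
  proof (rule eq_if_agree_on_relevant[where n = n and f = f])
    fix j assume j: "depends_on n f j"
    show "mix {i. \<beta> i = fst e} u (snd e) j = mix {i. \<beta> i = fst e} v (snd e) j"
    proof (cases "\<beta> j = fst e")
      case True
      then have "j = i"
        using inj_onD[OF inj, of j i] i j by simp
      then show ?thesis
        using that i by (simp add: mix_def)
    qed (simp add: mix_def)
  qed (use that e in auto)
  obtain a b where ab: "a \<in> cube n" "b \<in> cube n" "?F a \<noteq> ?F b"
    using wit by (auto simp: witnessed_def)
  have diff: "?F u \<noteq> ?F v" if uv: "u \<in> cube n" "v \<in> cube n" "u i \<noteq> v i" for u v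
  proof -
    have "a i \<noteq> b i"
      using same[OF ab(1,2)] ab(3) by blast
    then consider "u i = a i" "v i = b i" | "u i = b i" "v i = a i"
      using uv(3) by (cases "a i"; cases "b i"; cases "u i"; cases "v i") simp_all
    then show ?thesis
      using same[of u a] same[of v b] same[of u b] same[of v a] ab uv by cases auto
  qed
  have "i < n"
    using i by (simp add: depends_on_def)
  then have "xorp n z x i \<longleftrightarrow> z i \<noteq> x i"
    by (simp add: xorp_def)
  then show ?thesis
    unfolding dec_def using same[OF x(2) xorp_in_cube[of n z x]] diff[OF x(2) xorp_in_cube[of n z x]]
    by (cases "x i") auto
qed

section \<open>Random partitions separate the relevant variables\<close>

lemma prob_collision:
  fixes i j n r :: nat
  assumes "i < n" "j < n" "i \<noteq> j" "0 < r"
  shows "measure_pmf.prob (pmf_of_set ({..<n} \<rightarrow>\<^sub>E {..<r})) {\<beta>. \<beta> i = \<beta> j} \<le> 1 / real r"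
proof -
  let ?X = "{..<n} \<rightarrow>\<^sub>E {..<r}"
  have fin: "finite ?X"
    by (rule finite_PiE) auto
  have ne: "?X \<noteq> {}"
    using \<open>0 < r\<close> by (auto simp: PiE_eq_empty_iff)
  let ?A = "?X \<inter> {\<beta>. \<beta> i = \<beta> j}"
  let ?h = "\<lambda>(\<beta>, c). \<beta>(j := c)"
  \<comment> \<open>A collision determines \<open>\<beta> j\<close>, so that value can be overwritten freely.\<close>
  have inj: "inj_on ?h (?A \<times> {..<r})"
  proof (rule inj_onI)
    fix p q assume p: "p \<in> ?A \<times> {..<r}" and q: "q \<in> ?A \<times> {..<r}" and eq: "?h p = ?h q"
    obtain a c b d where pq: "p = (a, c)" "q = (b, d)"
      by (metis surj_pair)
    have eq': "a(j := c) = b(j := d)"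
      using eq by (simp add: pq)
    have upd: "(a(j := c)) l = (b(j := d)) l" for l
      by (simp only: eq')
    have "a l = b l" if "l \<noteq> j" for l
      using upd[of l] that by simp
    moreover have "c = d"
      using upd[of j] by simp
    moreover have "a i = a j" "b i = b j"
      using p q pq by auto
    ultimately have "a l = b l" for l
      using \<open>i \<noteq> j\<close> by (cases "l = j") auto
    then show "p = q"
      using pq \<open>c = d\<close> by auto
  qed
  have "?h ` (?A \<times> {..<r}) \<subseteq> ?X"
    using \<open>j < n\<close> by (auto simp: PiE_def extensional_def Pi_def)
  then have "card (?h ` (?A \<times> {..<r})) \<le> card ?X"
    by (rule card_mono[OF fin])
  then have "card ?A * r \<le> card ?X"
    by (simp add: card_image[OF inj] card_cartesian_product)
  then have "real (card ?A) * real r \<le> real (card ?X)"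
    by (simp only: of_nat_mult[symmetric] of_nat_le_iff)
  moreover have "0 < card ?X"
    using fin ne by (simp add: card_gt_0_iff)
  ultimately have "real (card ?A) / real (card ?X) \<le> 1 / real r"
    using \<open>0 < r\<close> by (simp only: of_nat_0_less_iff divide_simps) simp
  then show ?thesis
    by (simp only: measure_pmf_of_set[OF ne fin])
qed

lemma prob_not_isolating:
  fixes n r k :: nat
  assumes "R \<subseteq> {..<n}" "card R \<le> k" "0 < r"
  shows "measure_pmf.prob (pmf_of_set ({..<n} \<rightarrow>\<^sub>E {..<r})) {\<beta>. \<not> inj_on \<beta> R} \<le> real (k * k) / real r"
proof -
  let ?U = "pmf_of_set ({..<n} \<rightarrow>\<^sub>E {..<r})"
  let ?I = "{(i, j) \<in> R \<times> R. i \<noteq> j}"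
  have fin: "finite R"
    using assms(1) finite_subset by blast
  then have finI: "finite ?I"
    by (intro finite_subset[of ?I "R \<times> R"]) auto
  have Un: "{\<beta>. \<not> inj_on \<beta> R} = (\<Union>p\<in>?I. {\<beta>. \<beta> (fst p) = \<beta> (snd p)})"
    unfolding inj_on_def by (auto, blast)
  have "measure_pmf.prob ?U {\<beta>. \<not> inj_on \<beta> R} \<le> (\<Sum>p\<in>?I. measure_pmf.prob ?U {\<beta>. \<beta> (fst p) = \<beta> (snd p)})"
    unfolding Un by (rule measure_pmf.finite_measure_subadditive_finite[OF finI]) simp
  also have "\<dots> \<le> (\<Sum>p\<in>?I. 1 / real r)"
    using assms(1,3) by (intro sum_mono prob_collision) auto
  also have "\<dots> = real (card ?I) / real r"
    by simp
  also have "\<dots> \<le> real (k * k) / real r"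
  proof -
    have "card ?I \<le> card (R \<times> R)"
      by (rule card_mono) (use fin in auto)
    also have "\<dots> \<le> k * k"
      unfolding card_cartesian_product by (rule mult_le_mono[OF assms(2,2)])
    finally show ?thesis
      by (rule divide_right_mono[OF of_nat_mono of_nat_0_le_iff])
  qed
  finally show ?thesis .
qed

subsection \<open>The tester and its number of oracle calls\<close>

definition smallest :: "nat \<Rightarrow> boolfun set \<Rightarrow> boolfun" where
  "smallest n H = arg_min_on (\<lambda>g. card (sat n g)) H"

lemma smallest:
  assumes "finite H" "H \<noteq> {}"
  shows "smallest n H \<in> H" "\<And>g. g \<in> H \<Longrightarrow> card (sat n (smallest n H)) \<le> card (sat n g)"
  using arg_min_if_finite[OF assms, of "\<lambda>g. card (sat n g)"] unfolding smallest_def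
  by (auto simp: not_less[symmetric])

definition consistent :: "boolfun set \<Rightarrow> point option list \<Rightarrow> boolfun set" where
  "consistent G vs = {g \<in> G. \<forall>v\<in>set vs. \<exists>z. v = Some z \<and> g z}"

definition verdict :: "nat \<Rightarrow> nat \<Rightarrow> nat \<Rightarrow> nat \<Rightarrow> (nat \<Rightarrow> nat) \<Rightarrow> boolfun set \<Rightarrow> (nat \<times> point) list \<Rightarrow> boolfun \<Rightarrow> bool pmf" where
  "verdict n t m m' \<beta> G st f =
     bind_pmf (replicate_pmf m (zsample n t \<beta> st f)) (\<lambda>vs.
       if consistent G vs = {} then return_pmf False
       else map_pmf (\<lambda>bs. \<forall>b\<in>set bs. b) (replicate_pmf m' (check n t \<beta> st (smallest n (consistent G vs)) f)))"

primrec dictator_test :: "nat \<Rightarrow> nat \<Rightarrow> (nat \<Rightarrow> nat) \<Rightarrow> (nat \<times> point) list \<Rightarrow> boolfun \<Rightarrow> bool pmf" where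
  "dictator_test n u \<beta> [] f = return_pmf True"
| "dictator_test n u \<beta> (e # st) f =
     bind_pmf (replicate_pmf u (dictator_round n (probe \<beta> f e))) (\<lambda>bs.
       if \<forall>b\<in>set bs. b then dictator_test n u \<beta> st f else return_pmf False)"

text \<open>Both conditions on \<open>st\<close> are checked explicitly, so that soundness can be
  shown for every list, however the search produced it.\<close>

definition finish :: "nat \<Rightarrow> nat \<Rightarrow> nat \<Rightarrow> nat \<Rightarrow> nat \<Rightarrow> nat \<Rightarrow> (nat \<Rightarrow> nat) \<Rightarrow> boolfun set \<Rightarrow> (nat \<times> point) list \<Rightarrow> boolfun \<Rightarrow> bool pmf" where
  "finish n k u t m m' \<beta> G st f =
     (if distinct (map fst st) \<and> length st \<le> k
      then bind_pmf (dictator_test n u \<beta> st f) (\<lambda>b. if b then verdict n t m m' \<beta> G st f else return_pmf False)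
      else return_pmf False)"

definition tester :: "nat \<Rightarrow> nat \<Rightarrow> nat \<Rightarrow> nat \<Rightarrow> nat \<Rightarrow> nat \<Rightarrow> nat \<Rightarrow> nat \<Rightarrow> boolfun set \<Rightarrow> boolfun \<Rightarrow> bool pmf" where
  "tester n k s M u t m m' G f =
     bind_pmf (pmf_of_set ({..<n} \<rightarrow>\<^sub>E {..<2 ^ s})) (\<lambda>\<beta>.
       bind_pmf (search n s M \<beta> (Suc k) [] f) (\<lambda>st. finish n k u t m m' \<beta> G st f))"

section \<open>Counting oracle calls\<close>

lemma computes_pair_random:
  assumes "computes n D c"
  shows "computes n (\<lambda>f. pair_pmf (D f) q) c"
  unfolding pair_pmf_def
  using computes_bind[OF assms, of "\<lambda>x f. bind_pmf q (\<lambda>y. return_pmf (x, y))" 0]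
  by (simp add: computes_random)

lemma computes_dec: "computes n (\<lambda>f. return_pmf (dec n (probe \<beta> f e) x z)) 2"
  unfolding dec_def probe_def
  using computes_map2[OF computes_query computes_query, where h = "(\<noteq>)"] by (simp add: numeral_2_eq_2)

lemma computes_dec1: "computes n (\<lambda>f. dec1 n t (probe \<beta> f e) x) (2 * t)"
proof -
  have "computes n (\<lambda>f. map_pmf (dec n (probe \<beta> f e) x) (unif n)) 2"
    unfolding map_pmf_def by (rule computes_bind_random[OF computes_dec])
  from computes_map[OF computes_replicate[OF this]] show ?thesis
    by (simp add: dec1_def mult.commute)
qed

lemma computes_decode: "computes n (\<lambda>f. decode n t \<beta> f x st) (length st * (2 * t))"
proof (induction st)
  case (Cons e st)
  show ?case
    using computes_bind[OF computes_dec1 computes_map[OF Cons]] by simp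
qed (simp add: computes_return)

lemma computes_zsample: "computes n (zsample n t \<beta> st) (1 + length st * (2 * t))"
proof -
  have "computes n (\<lambda>f. zsample n t \<beta> st f) (1 + length st * (2 * t))"
    unfolding zsample_def
    by (rule computes_bind[OF computes_pair_random[OF computes_sample] computes_map[OF computes_decode]])
  then show ?thesis
    by simp
qed

lemma computes_check: "computes n (check n t \<beta> st g) (length st * (2 * t) + 1)"
proof -
  have "computes n (\<lambda>f. case d of None \<Rightarrow> return_pmf False
      | Some bs \<Rightarrow> return_pmf (f (adjust n \<beta> st bs (fst p) (snd p)))) 1" for d :: "bool list option" and p
    using computes_mono[OF computes_return] computes_query by (cases d) auto
  from computes_bind[OF computes_decode this]
  have "computes n (\<lambda>f. bind_pmf (decode n t \<beta> f (snd p) st) (\<lambda>d. case d of None \<Rightarrow> return_pmf False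
      | Some bs \<Rightarrow> return_pmf (f (adjust n \<beta> st bs (fst p) (snd p))))) (length st * (2 * t) + 1)" for p
    by this
  from computes_bind_random[OF this]
  have "computes n (\<lambda>f. bind_pmf (pair_pmf (pmf_of_set (sat n g)) (unif n)) (\<lambda>p.
      bind_pmf (decode n t \<beta> f (snd p) st) (\<lambda>d. case d of None \<Rightarrow> return_pmf False
      | Some bs \<Rightarrow> return_pmf (f (adjust n \<beta> st bs (fst p) (snd p)))))) (length st * (2 * t) + 1)" .
  moreover have "(case d of None \<Rightarrow> return_pmf False
      | Some bs \<Rightarrow> return_pmf (f (adjust n \<beta> st bs (fst p) (snd p))))
    = return_pmf (case d of None \<Rightarrow> False | Some bs \<Rightarrow> f (adjust n \<beta> st bs (fst p) (snd p)))" for d f p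
    by (cases d) auto
  ultimately show ?thesis
    by (simp add: check_def[abs_def] map_pmf_def)
qed

lemma computes_verdict:
  "computes n (verdict n t m m' \<beta> G st)
     (m * (1 + length st * (2 * t)) + m' * (length st * (2 * t) + 1))"
proof -
  have "computes n (\<lambda>f. verdict n t m m' \<beta> G st f)
     (m * (1 + length st * (2 * t)) + m' * (length st * (2 * t) + 1))"
    unfolding verdict_def
  proof (rule computes_bind[OF computes_replicate[OF computes_zsample]], rule computes_if)
    show "computes n (\<lambda>f. return_pmf False) (m' * (length st * (2 * t) + 1))"
      by (rule computes_mono[OF computes_return]) simp
    show "computes n (\<lambda>f. map_pmf (\<lambda>bs. \<forall>b\<in>set bs. b)
        (replicate_pmf m' (check n t \<beta> st (smallest n (consistent G vs)) f))) (m' * (length st * (2 * t) + 1))" for vs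
      by (rule computes_map[OF computes_replicate[OF computes_check]])
  qed
  then show ?thesis
    by simp
qed

lemma computes_dictator_round: "computes n (\<lambda>f. dictator_round n (probe \<beta> f e)) 12"
proof -
  let ?d = "\<lambda>f. dec n (probe \<beta> f e)"
  have "computes n (\<lambda>f. return_pmf ((?d f x z = ?d f x z') \<and>
      ((?d f (andp n x y) z = (?d f x z \<and> ?d f y z)) \<and> ?d f (onep n) z))) (2 + 2 + (2 + (2 + 2) + 2))" for x y z z'
    by (intro computes_map2[where h = "(\<and>)"] computes_map2[where h = "(=)"] computes_dec)
  from computes_bind_random[OF computes_bind_random[OF computes_bind_random[OF computes_bind_random[OF this]]]]
  show ?thesis
    unfolding dictator_round_def round_ok_def by simp
qed

lemma computes_dictator_test: "computes n (dictator_test n u \<beta> st) (length st * (u * 12))"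
proof (induction st)
  case (Cons e st)
  have "computes n (\<lambda>f. if b then dictator_test n u \<beta> st f else return_pmf False) (length st * (u * 12))" for b
    using Cons computes_mono[OF computes_return] by (cases b) auto
  from computes_bind[OF computes_replicate[OF computes_dictator_round] this] show ?case
    by simp
qed (simp add: computes_return)

lemma computes_finish:
  "computes n (finish n k u t m m' \<beta> G st)
     (k * (u * 12) + (m * (1 + k * (2 * t)) + m' * (k * (2 * t) + 1)))"
proof (cases "distinct (map fst st) \<and> length st \<le> k")
  case True
  have "computes n (\<lambda>f. if b then verdict n t m m' \<beta> G st f else return_pmf False)
      (m * (1 + length st * (2 * t)) + m' * (length st * (2 * t) + 1))" for b
    using computes_verdict computes_mono[OF computes_return] by (cases b) auto
  from computes_bind[OF computes_dictator_test this]
  have "computes n (finish n k u t m m' \<beta> G st)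
     (length st * (u * 12) + (m * (1 + length st * (2 * t)) + m' * (length st * (2 * t) + 1)))"
    using True by (simp add: finish_def[abs_def])
  then show ?thesis
    by (rule computes_mono) (use True in \<open>intro add_mono mult_le_mono order_refl; simp\<close>)
next
  case False
  then have "finish n k u t m m' \<beta> G st = (\<lambda>f. return_pmf False)"
    by (auto simp: finish_def)
  then show ?thesis
    using computes_mono[OF computes_return] by simp
qed

lemma computes_trial: "computes n (trial n \<beta> S) 2"
proof -
  have "computes n (\<lambda>f. trial n \<beta> S f) (1 + 1)"
    unfolding trial_def
    by (rule computes_bind[OF computes_pair_random[OF computes_sample]
      computes_map1[where h = "\<lambda>b. if b then None else Some _", OF computes_query]])
  then show ?thesis
    by (simp add: numeral_2_eq_2)
qed

lemma computes_locate: "computes n (\<lambda>f. return_pmf (locate s \<beta> S p f)) s"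
  unfolding locate_def Let_def by (rule computes_map1[OF computes_bsearch])

lemma computes_phase: "computes n (phase n s M \<beta> S) (M * 2 + s)"
proof -
  have "computes n (\<lambda>f. phase n s M \<beta> S f) (M * 2 + s)"
    unfolding phase_def
  proof (rule computes_bind[OF computes_replicate[OF computes_trial]])
    show "computes n (\<lambda>f. case List.find (\<lambda>o'. o' \<noteq> None) os of None \<Rightarrow> return_pmf None
        | Some o' \<Rightarrow> return_pmf (Some (locate s \<beta> S (the o') f))) s" for os
      using computes_mono[OF computes_return] computes_map1[OF computes_locate, where h = Some]
      by (cases "List.find (\<lambda>o'. o' \<noteq> None) os") auto
  qed
  then show ?thesis
    by simp
qed

lemma computes_search: "computes n (search n s M \<beta> p st) (p * (M * 2 + s))"
proof (induction p arbitrary: st)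
  case 0
  have "search n s M \<beta> 0 st = (\<lambda>f. return_pmf st)"
    by (rule ext) simp
  then show ?case
    by (simp add: computes_return)
next
  case (Suc p)
  have "computes n (\<lambda>f. case r of None \<Rightarrow> return_pmf st | Some e \<Rightarrow> search n s M \<beta> p (e # st) f)
      (p * (M * 2 + s))" for r
    using Suc computes_mono[OF computes_return] by (cases r) auto
  from computes_bind[OF computes_phase this] show ?case
    by simp
qed

lemma computes_tester:
  "computes n (tester n k s M u t m m' G)
     (Suc k * (M * 2 + s) + (k * (u * 12) + (m * (1 + k * (2 * t)) + m' * (k * (2 * t) + 1))))"
proof -
  have "computes n (\<lambda>f. tester n k s M u t m m' G f)
     (Suc k * (M * 2 + s) + (k * (u * 12) + (m * (1 + k * (2 * t)) + m' * (k * (2 * t) + 1))))"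
    unfolding tester_def
    by (rule computes_bind_random[OF computes_bind[OF computes_search computes_finish]])
  then show ?thesis
    by simp
qed

subsection \<open>Soundness and completeness of the tester\<close>

lemma finite_boolfuns: "finite (boolfuns n)"
  unfolding boolfuns_def by (rule finite_PiE) auto

text \<open>Three failures are possible: a sample contradicts \<open>g0\<close>, which is
  \<open>f\<close> relabelled and errs with probability \<open>miss n T f f\<close>; a candidate
  with \<open>miss\<close> above \<open>\<eta>\<close> survives; or a check fails. The last is rare
  because the chosen candidate is no larger than \<open>g0\<close>.\<close>

lemma verdict_rejects_le:
  assumes lb: "labelled_blocks n \<beta> st \<tau> \<pi>"
    and G: "finite G" "g0 \<in> G"
    and lit: "\<And>e x z. e \<in> set st \<Longrightarrow> x \<in> cube n \<Longrightarrow> z \<in> cube n \<Longrightarrow> dec n (probe \<beta> f e) x z = x (\<tau> (fst e))"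
    and f: "sat n f \<noteq> {}" and t: "0 < t"
    and g0: "permute_vars n \<pi> g0 = f"
    and self: "miss n (labelled_blocks.T st \<tau>) f f \<le> \<delta>"
    and \<eta>: "0 \<le> \<eta>" "\<eta> \<le> 1 / 2"
  shows "measure_pmf.prob (verdict n t m m' \<beta> G st f) {False}
    \<le> real m * \<delta> + real (card G) * (1 - \<eta>) ^ m + real m' * (2 * \<eta>)"
proof -
  interpret labelled_blocks n \<beta> st \<tau> \<pi>
    by (rule lb)
  let ?Z = "zsample n t \<beta> st f"
  let ?hat = "permute_vars n \<pi>"
  let ?ok = "\<lambda>g v. \<exists>z. v = Some z \<and> g z"
  define Bad where "Bad = {g \<in> G. \<eta> < miss n T f (?hat g)}"
  have Z: "measure_pmf.prob ?Z {v. \<not> ?ok g v} = miss n T f (?hat g)" for g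
    by (rule zsample_inconsistent_eq[OF lit f t])
  have finBad: "finite Bad" and cardBad: "card Bad \<le> card G"
    using G(1) by (auto simp: Bad_def intro: card_mono)
  have B1: "measure_pmf.prob (replicate_pmf m ?Z) {vs. \<exists>v\<in>set vs. \<not> ?ok g0 v} \<le> real m * \<delta>"
  proof -
    have "measure_pmf.prob (replicate_pmf m ?Z) {vs. \<exists>v\<in>set vs. \<not> ?ok g0 v} \<le> real m * measure_pmf.prob ?Z {v. \<not> ?ok g0 v}"
      by (rule prob_replicate_pmf_ex)
    also have "\<dots> \<le> real m * \<delta>"
      unfolding Z g0 using self by (intro mult_left_mono) auto
    finally show ?thesis .
  qed
  have B2: "measure_pmf.prob (replicate_pmf m ?Z) {vs. \<exists>g\<in>Bad. \<forall>v\<in>set vs. ?ok g v} \<le> real (card G) * (1 - \<eta>) ^ m"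
  proof -
    have "measure_pmf.prob ?Z {v. ?ok g v} \<le> 1 - \<eta>" if "g \<in> Bad" for g
      using Z[of g] that unfolding prob_compl_pmf by (simp add: Bad_def)
    then have "measure_pmf.prob (replicate_pmf m ?Z) {vs. \<exists>g\<in>Bad. \<forall>v\<in>set vs. ?ok g v} \<le> real (card Bad) * (1 - \<eta>) ^ m"
      by (intro prob_replicate_pmf_union finBad)
    also have "\<dots> \<le> real (card G) * (1 - \<eta>) ^ m"
      using cardBad \<eta> by (intro mult_right_mono) auto
    finally show ?thesis .
  qed
  let ?B = "{vs. (\<exists>v\<in>set vs. \<not> ?ok g0 v) \<or> (\<exists>g\<in>Bad. \<forall>v\<in>set vs. ?ok g v)}"
  have "measure_pmf.prob (verdict n t m m' \<beta> G st f) {False}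
    \<le> measure_pmf.prob (replicate_pmf m ?Z) ?B + real m' * (2 * \<eta>)"
    unfolding verdict_def
  proof (rule prob_bind_le)
    fix vs assume "vs \<notin> ?B"
    then have vs: "\<And>v. v \<in> set vs \<Longrightarrow> ?ok g0 v" "\<And>g. g \<in> Bad \<Longrightarrow> \<not> (\<forall>v\<in>set vs. ?ok g v)"
      by auto
    let ?H = "consistent G vs"
    have H: "finite ?H" "g0 \<in> ?H"
      using G vs(1) by (auto simp: consistent_def)
    define g where "g = smallest n ?H"
    have g: "g \<in> ?H" "card (sat n g) \<le> card (sat n g0)"
      using smallest[of ?H] H by (auto simp: g_def)
    then have "g \<notin> Bad"
      using vs(2) unfolding consistent_def by blast
    then have m1: "miss n T f (?hat g) \<le> \<eta>"
      using g(1) by (auto simp: Bad_def consistent_def)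
    have "sat n (?hat g) \<noteq> {}"
      using sat_nonempty_if_miss[OF f, of T "?hat g"] m1 \<eta> by simp
    then have sat_g: "sat n g \<noteq> {}"
      using sat_permute_vars_empty[OF perm] by simp
    have "miss n T (?hat g) f \<le> 2 * \<eta>"
    proof (rule miss_swap_le[OF f _ m1 \<eta>(2)])
      show "card (sat n (?hat g)) \<le> card (sat n f)"
        using g(2) card_sat_permute_vars[OF perm, of g] card_sat_permute_vars[OF perm, of g0] g0 by simp
    qed
    then have c: "measure_pmf.prob (check n t \<beta> st g f) {b. \<not> b} \<le> 2 * \<eta>"
      using check_rejects_eq[OF lit sat_g t] by simp
    have "measure_pmf.prob (replicate_pmf m' (check n t \<beta> st g f)) {bs. \<exists>b\<in>set bs. \<not> b} \<le> real m' * (2 * \<eta>)"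
      by (rule order_trans[OF prob_replicate_pmf_ex]) (use c in \<open>auto intro: mult_left_mono\<close>)
    then show "measure_pmf.prob (if ?H = {} then return_pmf False
        else map_pmf (\<lambda>bs. \<forall>b\<in>set bs. b) (replicate_pmf m' (check n t \<beta> st (smallest n ?H) f))) {False}
       \<le> real m' * (2 * \<eta>)"
      using H by (auto simp: g_def[symmetric] vimage_def)
  qed (use \<eta> in simp)
  moreover have "measure_pmf.prob (replicate_pmf m ?Z) ?B \<le> real m * \<delta> + real (card G) * (1 - \<eta>) ^ m"
    using prob_disj_pmf[of "replicate_pmf m ?Z"] B1 B2 by (rule order_trans[OF _ add_mono])
  ultimately show ?thesis
    by simp
qed

text \<open>By \<open>rel_dist_le_miss\<close> each candidate is bad in some direction: a large
  \<open>miss\<close> from \<open>f\<close> is caught by the samples, a large \<open>miss\<close>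
  back to \<open>f\<close> by the checks. Half of \<open>\<eta>\<close> is given away to decoding
  errors.\<close>

lemma verdict_accepts_le:
  assumes lb: "labelled_blocks n \<beta> st \<tau> \<pi>"
    and G: "finite G"
    and lit: "\<And>e x. e \<in> set st \<Longrightarrow> x \<in> cube n \<Longrightarrow> dec_err n (probe \<beta> f e) x (x (\<tau> (fst e))) \<le> 1 / 8"
    and f: "sat n f \<noteq> {}"
    and far: "\<And>g. g \<in> G \<Longrightarrow> 6 * \<eta> < rel_dist n f (permute_vars n \<pi> g)"
    and \<eta>: "0 \<le> \<eta>" "\<eta> \<le> 1 / 2"
    and t: "real (length st) * (1 / 8) ^ t \<le> \<eta> / 2"
  shows "measure_pmf.prob (verdict n t m m' \<beta> G st f) {True}
    \<le> real (card G) * (1 - \<eta> / 2) ^ m + (1 - \<eta> / 2) ^ m'"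
proof -
  interpret labelled_blocks n \<beta> st \<tau> \<pi>
    by (rule lb)
  let ?Z = "zsample n t \<beta> st f"
  let ?hat = "permute_vars n \<pi>"
  let ?ok = "\<lambda>g v. \<exists>z. v = Some z \<and> g z"
  define Bad where "Bad = {g \<in> G. \<eta> < miss n T f (?hat g)}"
  have finBad: "finite Bad" and cardBad: "card Bad \<le> card G"
    using G by (auto simp: Bad_def intro: card_mono)
  have nonneg: "0 \<le> 1 - \<eta> / 2"
    using \<eta> by simp
  have B: "measure_pmf.prob (replicate_pmf m ?Z) {vs. \<exists>g\<in>Bad. \<forall>v\<in>set vs. ?ok g v} \<le> real (card G) * (1 - \<eta> / 2) ^ m"
  proof -
    have "measure_pmf.prob ?Z {v. ?ok g v} \<le> 1 - \<eta> / 2" if "g \<in> Bad" for g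
    proof -
      have "measure_pmf.prob ?Z {v. ?ok g v} \<le> 1 - miss n T f (?hat g) + real (length st) * (1 / 8) ^ t"
        by (rule zsample_consistent_le[OF lit f])
      then show ?thesis
        using that t by (simp add: Bad_def)
    qed
    then have "measure_pmf.prob (replicate_pmf m ?Z) {vs. \<exists>g\<in>Bad. \<forall>v\<in>set vs. ?ok g v} \<le> real (card Bad) * (1 - \<eta> / 2) ^ m"
      by (intro prob_replicate_pmf_union finBad)
    also have "\<dots> \<le> real (card G) * (1 - \<eta> / 2) ^ m"
      using cardBad nonneg by (intro mult_right_mono) auto
    finally show ?thesis .
  qed
  have "measure_pmf.prob (verdict n t m m' \<beta> G st f) {True}
    \<le> measure_pmf.prob (replicate_pmf m ?Z) {vs. \<exists>g\<in>Bad. \<forall>v\<in>set vs. ?ok g v} + (1 - \<eta> / 2) ^ m'"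
    unfolding verdict_def
  proof (rule prob_bind_le)
    fix vs assume vs: "vs \<notin> {vs. \<exists>g\<in>Bad. \<forall>v\<in>set vs. ?ok g v}"
    let ?H = "consistent G vs"
    show "measure_pmf.prob (if ?H = {} then return_pmf False
        else map_pmf (\<lambda>bs. \<forall>b\<in>set bs. b) (replicate_pmf m' (check n t \<beta> st (smallest n ?H) f))) {True}
       \<le> (1 - \<eta> / 2) ^ m'"
    proof (cases "?H = {}")
      case True
      then show ?thesis
        using nonneg by simp
    next
      case False
      define g where "g = smallest n ?H"
      have "finite ?H"
        using G by (auto simp: consistent_def)
      then have g: "g \<in> ?H"
        using smallest[of ?H] False by (auto simp: g_def)
      then have "g \<notin> Bad"
        using vs unfolding consistent_def by blast
      then have m1: "miss n T f (?hat g) \<le> \<eta>"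
        using g by (auto simp: Bad_def consistent_def)
      have "sat n (?hat g) \<noteq> {}"
        using sat_nonempty_if_miss[OF f, of T "?hat g"] m1 \<eta> by simp
      then have sat_g: "sat n g \<noteq> {}"
        using sat_permute_vars_empty[OF perm] by simp
      have "g \<in> G"
        using g by (simp add: consistent_def)
      then have m2: "\<eta> < miss n T (?hat g) f"
        using rel_dist_le_miss[OF f m1 _ \<eta>(2)] far[of g] by (cases "miss n T (?hat g) f \<le> \<eta>") auto
      have "measure_pmf.prob (check n t \<beta> st g f) {b. b} \<le> 1 - \<eta> / 2"
        using check_accepts_le[OF lit sat_g, of t] m2 t by simp
      then have "measure_pmf.prob (replicate_pmf m' (check n t \<beta> st g f)) {bs. \<forall>b\<in>set bs. b} \<le> (1 - \<eta> / 2) ^ m'"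
        unfolding prob_replicate_pmf_all by (intro power_mono) auto
      then show ?thesis
        using False by (simp add: g_def[symmetric] vimage_def)
    qed
  qed (use nonneg in simp)
  with B show ?thesis
    by simp
qed

lemma dictator_test_accepts_le:
  assumes "e \<in> set st" "1 / 33 \<le> measure_pmf.prob (dictator_round n (probe \<beta> f e)) {False}"
  shows "measure_pmf.prob (dictator_test n u \<beta> st f) {True} \<le> (32 / 33) ^ u"
  using assms(1)
proof (induction st)
  case (Cons e' st)
  show ?case
  proof (cases "e = e'")
    case True
    let ?r = "dictator_round n (probe \<beta> f e')"
    have "measure_pmf.prob ?r {b. \<not> b} = measure_pmf.prob ?r {False}"
      by (rule arg_cong[where f = "measure_pmf.prob ?r"]) auto
    then have r: "measure_pmf.prob ?r {b. b} \<le> 32 / 33"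
      using assms(2) True unfolding prob_compl_pmf by simp
    have "measure_pmf.prob (dictator_test n u \<beta> (e' # st) f) {True}
        \<le> measure_pmf.prob (replicate_pmf u ?r) {bs. \<forall>b\<in>set bs. b} + 0"
      unfolding dictator_test.simps by (rule prob_bind_le) auto
    also have "\<dots> \<le> (32 / 33) ^ u"
      unfolding prob_replicate_pmf_all using r by (auto intro!: power_mono)
    finally show ?thesis .
  next
    case False
    then show ?thesis
      unfolding dictator_test.simps using Cons by (intro prob_bind_le_const) auto
  qed
qed simp

lemma dictator_test_accepts:
  assumes "\<And>e. e \<in> set st \<Longrightarrow> dictator_round n (probe \<beta> f e) = return_pmf True"
  shows "dictator_test n u \<beta> st f = return_pmf True"
  using assms
proof (induction st)
  case (Cons e st)
  have "replicate_pmf u (return_pmf True) = return_pmf (replicate u True)"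
    by (induction u) (simp_all add: bind_return_pmf)
  then show ?case
    using Cons by (simp add: bind_return_pmf)
qed simp

text \<open>Flipping a variable outside the block leaves the probe unchanged, so the unit vector of
  \<open>t\<close> would always be decoded as false, with error 1.\<close>

lemma dictator_in_block:
  assumes "t < n" and lit: "\<And>x. x \<in> cube n \<Longrightarrow> dec_err n (probe \<beta> f e) x (x t) \<le> 1 / 8"
  shows "\<beta> t = fst e"
proof (rule ccontr)
  assume ne: "\<beta> t \<noteq> fst e"
  have "mix {i. \<beta> i = fst e} (xorp n z (unitp n t)) w = mix {i. \<beta> i = fst e} z w" if "z \<in> cube n" for z w
    using that ne by (auto simp: mix_def xorp_def unitp_def in_cube_iff)
  then have "\<not> dec n (probe \<beta> f e) (unitp n t) z" if "z \<in> cube n" for z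
    using that by (simp add: dec_def probe_def)
  then have "measure_pmf.prob (unif n) {z. True} \<le> dec_err n (probe \<beta> f e) (unitp n t) True"
    unfolding dec_err_def by (intro prob_mono_pmf) auto
  moreover have "unitp n t t"
    using assms(1) by (simp add: unitp_def)
  ultimately show False
    using lit[of "unitp n t"] by simp
qed

text \<open>Either some block violates the dictator condition and is exposed by \<open>u\<close>
  rounds, or all probes decode dictators. These lie in their own blocks, hence are distinct and
  extend to a relabelling, under which closure of \<open>C\<close> keeps all candidates far.\<close>

lemma finish_accepts_le:
  assumes C: "junta_subclass n k C" and f: "sat n f \<noteq> {}"
    and far: "\<And>g. g \<in> C \<Longrightarrow> 6 * \<eta> < rel_dist n f g"
    and \<eta>: "0 \<le> \<eta>" "\<eta> \<le> 1 / 2"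
    and t: "real k * (1 / 8) ^ t \<le> \<eta> / 2"
    and G: "G \<subseteq> C"
    and q: "(32 / 33) ^ u \<le> q" "real (card G) * (1 - \<eta> / 2) ^ m + (1 - \<eta> / 2) ^ m' \<le> q"
  shows "measure_pmf.prob (finish n k u t m m' \<beta> G st f) {True} \<le> q"
proof (cases "distinct (map fst st) \<and> length st \<le> k")
  case True
  have q0: "0 \<le> q"
    using q(1) by (rule order_trans[rotated]) simp
  show ?thesis
  proof (cases "\<exists>e\<in>set st. 1 / 33 \<le> measure_pmf.prob (dictator_round n (probe \<beta> f e)) {False}")
    case bad: True
    have "measure_pmf.prob (finish n k u t m m' \<beta> G st f) {True}
        \<le> measure_pmf.prob (dictator_test n u \<beta> st f) {True} + 0"
      unfolding finish_def if_P[OF True] by (rule prob_bind_le) auto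
    also have "\<dots> \<le> q"
    proof -
      from bad obtain e where "e \<in> set st" "1 / 33 \<le> measure_pmf.prob (dictator_round n (probe \<beta> f e)) {False}"
        by blast
      from order_trans[OF dictator_test_accepts_le[OF this] q(1)] show ?thesis
        by simp
    qed
    finally show ?thesis .
  next
    case False
    have "\<exists>s<n. \<forall>x\<in>cube n. dec_err n (probe \<beta> f e) x (x s) \<le> 1 / 8" if "e \<in> set st" for e
    proof -
      have "measure_pmf.prob (dictator_round n (probe \<beta> f e)) {False} < 1 / 33"
        using False that by force
      then show ?thesis
        by (rule dictator_if_round_accepts) blast
    qed
    then obtain \<sigma> where \<sigma>: "\<And>e. e \<in> set st \<Longrightarrow> \<sigma> e < n"
      "\<And>e x. e \<in> set st \<Longrightarrow> x \<in> cube n \<Longrightarrow> dec_err n (probe \<beta> f e) x (x (\<sigma> e)) \<le> 1 / 8"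
      by metis
    \<comment> \<open>The dictator belongs to an entry, whereas \<open>\<tau>\<close> takes a block
      number; since the numbers are distinct, the lookup recovers the entry.\<close>
    define \<tau> where "\<tau> j = \<sigma> (j, the (map_of st j))" for j
    have \<tau>_\<sigma>: "\<tau> (fst e) = \<sigma> e" if "e \<in> set st" for e
      using map_of_is_SomeI[OF conjunct1[OF True], of "fst e" "snd e"] that by (simp add: \<tau>_def)
    have \<beta>\<tau>: "\<beta> (\<tau> (fst e)) = fst e" if "e \<in> set st" for e
      unfolding \<tau>_\<sigma>[OF that] by (rule dictator_in_block[OF \<sigma>[OF that]])
    let ?ts = "map (\<lambda>e. \<tau> (fst e)) st"
    have dts: "distinct ?ts"
    proof -
      have "map \<beta> ?ts = map fst st"
        using \<beta>\<tau> by simp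
      then show ?thesis
        using True by (metis distinct_map)
    qed
    have \<tau>_less: "\<tau> (fst e) < n" if "e \<in> set st" for e
      using \<sigma>(1)[OF that] \<tau>_\<sigma>[OF that] by simp
    then have "set ?ts \<subseteq> {..<n}"
      by auto
    then obtain \<pi> where \<pi>: "\<pi> permutes {..<n}" "\<forall>i<length ?ts. \<pi> i = ?ts ! i"
      using extend_to_permutation[OF dts order_refl] by blast
    have lb: "labelled_blocks n \<beta> st \<tau> \<pi>"
    proof
      show "distinct (map fst st)"
        using True by simp
      show "\<pi> i = \<tau> (fst (st ! i))" if "i < length st" for i
        using \<pi>(2) that by simp
    qed (fact \<tau>_less \<beta>\<tau> \<pi>(1))+
    have far': "6 * \<eta> < rel_dist n f (permute_vars n \<pi> g)" if "g \<in> G" for g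
      using C G that \<pi>(1) by (intro far) (auto simp: junta_subclass_def)
    have "finite G"
      using C G finite_boolfuns[of n] by (auto simp: junta_subclass_def intro: finite_subset)
    moreover have "real (length st) * (1 / 8) ^ t \<le> \<eta> / 2"
      by (rule order_trans[OF mult_right_mono t]) (use True in auto)
    ultimately have v: "measure_pmf.prob (verdict n t m m' \<beta> G st f) {True} \<le> q"
      using verdict_accepts_le[OF lb _ _ f far' \<eta>, where t = t and m = m and m' = m'] \<sigma>(2) \<tau>_\<sigma> q(2) by fastforce
    show ?thesis
      unfolding finish_def if_P[OF True]
    proof (rule prob_bind_le_const[OF q0])
      show "measure_pmf.prob (if b then verdict n t m m' \<beta> G st f else return_pmf False) {True} \<le> q" for b
        using v q0 by (cases b) auto
    qed
  qed
next
  case False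
  then show ?thesis
    using q(1) by (auto simp: finish_def intro: order_trans[rotated])
qed

lemma tester_accepts_le:
  assumes "junta_subclass n k C" "sat n f \<noteq> {}"
    "\<And>g. g \<in> C \<Longrightarrow> 6 * \<eta> < rel_dist n f g"
    "0 \<le> \<eta>" "\<eta> \<le> 1 / 2" "real k * (1 / 8) ^ t \<le> \<eta> / 2" "G \<subseteq> C"
    "(32 / 33) ^ u \<le> q" "real (card G) * (1 - \<eta> / 2) ^ m + (1 - \<eta> / 2) ^ m' \<le> q"
  shows "measure_pmf.prob (tester n k s M u t m m' G f) {True} \<le> q"
proof -
  have q0: "0 \<le> q"
    using assms(8) by (rule order_trans[rotated]) simp
  show ?thesis
    unfolding tester_def
    by (intro prob_bind_le_const[OF q0] finish_accepts_le) (use assms in auto)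
qed

lemma finish_rejects_le:
  assumes C: "junta_subclass n k C" and fC: "f \<in> C" and f: "sat n f \<noteq> {}"
    and inj: "inj_on \<beta> {i. depends_on n f i}"
    and valid: "valid_blocks n \<beta> f st" and self: "miss n {i. \<beta> i \<in> fst ` set st} f f \<le> \<delta>"
    and \<eta>: "0 \<le> \<eta>" "\<eta> \<le> 1 / 2" and t: "0 < t"
  shows "measure_pmf.prob (finish n k u t m m' \<beta> (first_vars_part n k C) st f) {False}
    \<le> real m * \<delta> + real (card (first_vars_part n k C)) * (1 - \<eta>) ^ m + real m' * (2 * \<eta>)"
proof -
  let ?R = "{i. depends_on n f i}"
  have junta: "is_junta n k f" and fb: "f \<in> boolfuns n"
    using C fC by (auto simp: junta_subclass_def)
  have len: "length st \<le> k"
    by (rule length_valid_blocks[OF valid junta])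
  have dist: "distinct (map fst st)" and wit: "\<And>e. e \<in> set st \<Longrightarrow> witnessed n \<beta> f e"
    using valid by (auto simp: valid_blocks_def)
  have "\<exists>i. depends_on n f i \<and> \<beta> i = j" if "j \<in> fst ` set st" for j
  proof -
    from that obtain e where "e \<in> set st" "j = fst e"
      by auto
    then show ?thesis
      using witnessed_relevant[OF wit] by metis
  qed
  then obtain \<tau> where "\<And>j. j \<in> fst ` set st \<Longrightarrow> depends_on n f (\<tau> j) \<and> \<beta> (\<tau> j) = j"
    by metis
  then have \<tau>: "depends_on n f (\<tau> (fst e))" "\<beta> (\<tau> (fst e)) = fst e" if "e \<in> set st" for e
    using that by auto
  have lit: "dec n (probe \<beta> f e) x z = x (\<tau> (fst e))" if "e \<in> set st" "x \<in> cube n" "z \<in> cube n" for e x z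
    by (rule isolated_probe[OF wit inj \<tau>]) (use that in auto)
  let ?ts = "map (\<lambda>e. \<tau> (fst e)) st"
  have dts: "distinct ?ts"
  proof -
    have "map \<beta> ?ts = map fst st"
      using \<tau> by simp
    then show ?thesis
      using dist by (metis distinct_map)
  qed
  have sub: "set ?ts \<subseteq> ?R" "?R \<subseteq> {..<n}"
    using \<tau>(1) by (auto simp: depends_on_def)
  obtain \<pi> where \<pi>: "\<pi> permutes {..<n}" "\<forall>i<length ?ts. \<pi> i = ?ts ! i"
    "\<pi> ` {..<card ?R} = ?R"
    using extend_to_permutation[OF dts sub] by blast
  have \<tau>_less: "\<tau> (fst e) < n" if "e \<in> set st" for e
    using \<tau>(1)[OF that] by (simp add: depends_on_def)
  have lb: "labelled_blocks n \<beta> st \<tau> \<pi>"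
  proof
    show "\<pi> i = \<tau> (fst (st ! i))" if "i < length st" for i
      using \<pi>(2) that by simp
  qed (fact dist \<tau>_less \<tau>(2) \<pi>(1))+
  \<comment> \<open>Pulling \<open>f\<close> back along \<open>\<pi>\<close> moves all relevant
    variables below index \<open>k\<close>, so \<open>f\<close> is represented among the candidates
    even if some of its variables were not found.\<close>
  define g0 where "g0 = permute_vars n (inv \<pi>) f"
  have hat_g0: "permute_vars n \<pi> g0 = f"
    unfolding g0_def by (rule permute_vars_inv[OF \<pi>(1) fb])
  have "g0 \<in> C"
    using C fC permutes_inv[OF \<pi>(1)] by (auto simp: junta_subclass_def g0_def)
  moreover have "\<not> depends_on n g0 i" if "k \<le> i" for i
  proof
    assume "depends_on n g0 i"
    then have "\<pi> i \<in> \<pi> ` {..<card ?R}"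
      unfolding \<pi>(3) using depends_on_permute_vars[OF \<pi>(1)] by (simp add: g0_def)
    then have "i < card ?R"
      using permutes_inj[OF \<pi>(1)] by (auto simp: inj_def)
    then show False
      using junta that by (simp add: is_junta_def)
  qed
  ultimately have g0: "g0 \<in> first_vars_part n k C"
    by (simp add: first_vars_part_def)
  have fin: "finite (first_vars_part n k C)"
    using C finite_boolfuns[of n] by (auto simp: junta_subclass_def first_vars_part_def intro: finite_subset)
  \<comment> \<open>By isolation, the found blocks and their hidden variables contain the same
    relevant coordinates, so both mixes give \<open>f\<close> the same value.\<close>
  have "miss n (labelled_blocks.T st \<tau>) f f = miss n {i. \<beta> i \<in> fst ` set st} f f"
    unfolding miss_def
  proof (rule prob_cong_pmf)
    fix p assume "p \<in> set_pmf (pair_pmf (pmf_of_set (sat n f)) (unif n))"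
    then have p: "fst p \<in> cube n" "snd p \<in> cube n"
      using f by (auto simp: sat_def)
    have "f (mix (labelled_blocks.T st \<tau>) (fst p) (snd p)) = f (mix {i. \<beta> i \<in> fst ` set st} (fst p) (snd p))"
    proof (rule eq_if_agree_on_relevant[where n = n and f = f])
      fix i assume i: "depends_on n f i"
      have "i \<in> labelled_blocks.T st \<tau> \<longleftrightarrow> \<beta> i \<in> fst ` set st"
      proof
        assume "i \<in> labelled_blocks.T st \<tau>"
        then show "\<beta> i \<in> fst ` set st"
          using \<tau> by (auto simp: labelled_blocks.T_def[OF lb] intro: rev_image_eqI)
      next
        assume "\<beta> i \<in> fst ` set st"
        then obtain e where e: "e \<in> set st" "\<beta> i = fst e"
          by auto
        then have "i = \<tau> (fst e)"
          using inj_onD[OF inj, of i "\<tau> (fst e)"] \<tau>[OF e(1)] i by simp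
        then show "i \<in> labelled_blocks.T st \<tau>"
          using e by (auto simp: labelled_blocks.T_def[OF lb])
      qed
      then show "mix (labelled_blocks.T st \<tau>) (fst p) (snd p) i = mix {i. \<beta> i \<in> fst ` set st} (fst p) (snd p) i"
        by (simp add: mix_def)
    qed (use p in auto)
    then show "(\<not> f (mix (labelled_blocks.T st \<tau>) (fst p) (snd p))) = (\<not> f (mix {i. \<beta> i \<in> fst ` set st} (fst p) (snd p)))"
      by simp
  qed
  then have self': "miss n (labelled_blocks.T st \<tau>) f f \<le> \<delta>"
    using self by simp
  have "dictator_test n u \<beta> st f = return_pmf True"
    by (rule dictator_test_accepts, rule dictator_round_accepts) (use lit \<tau>_less in auto)
  then have "finish n k u t m m' \<beta> (first_vars_part n k C) st f = verdict n t m m' \<beta> (first_vars_part n k C) st f"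
    using dist len by (simp add: finish_def bind_return_pmf)
  then show ?thesis
    using verdict_rejects_le[OF lb fin g0 lit f t hat_g0 self' \<eta>] by simp
qed

lemma tester_rejects_le:
  assumes C: "junta_subclass n k C" and fC: "f \<in> C" and f: "sat n f \<noteq> {}"
    and \<delta>: "0 \<le> \<delta>" "\<delta> \<le> 1" and \<eta>: "0 \<le> \<eta>" "\<eta> \<le> 1 / 2" and t: "0 < t"
  shows "measure_pmf.prob (tester n k s M u t m m' (first_vars_part n k C) f) {False}
    \<le> real (k * k) / 2 ^ s + real (Suc k) * (1 - \<delta>) ^ M +
      (real m * \<delta> + real (card (first_vars_part n k C)) * (1 - \<eta>) ^ m + real m' * (2 * \<eta>))"
proof -
  let ?R = "{i. depends_on n f i}"
  let ?P = "pmf_of_set ({..<n} \<rightarrow>\<^sub>E {..<2 ^ s :: nat})"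
  let ?F = "\<lambda>\<beta> st. finish n k u t m m' \<beta> (first_vars_part n k C) st f"
  define b where "b = real m * \<delta> + real (card (first_vars_part n k C)) * (1 - \<eta>) ^ m + real m' * (2 * \<eta>)"
  have b0: "0 \<le> b"
    using \<delta> \<eta> by (simp add: b_def)
  have junta: "is_junta n k f"
    using C fC by (auto simp: junta_subclass_def)
  have setP: "set_pmf ?P = ({..<n} \<rightarrow>\<^sub>E {..<2 ^ s})"
    by (intro set_pmf_of_set finite_PiE) (auto simp: PiE_eq_empty_iff lessThan_empty_iff)
  have "measure_pmf.prob (tester n k s M u t m m' (first_vars_part n k C) f) {False}
    \<le> measure_pmf.prob ?P {\<beta>. \<not> inj_on \<beta> ?R} + (real (Suc k) * (1 - \<delta>) ^ M + b)"
    unfolding tester_def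
  proof (rule prob_bind_le)
    fix \<beta> assume \<beta>: "\<beta> \<in> set_pmf ?P" "\<beta> \<notin> {\<beta>. \<not> inj_on \<beta> ?R}"
    have less: "\<beta> i < 2 ^ s" if "i < n" for i
      using \<beta>(1) that unfolding setP by auto
    have "measure_pmf.prob (bind_pmf (search n s M \<beta> (Suc k) [] f) (?F \<beta>)) {False}
      \<le> measure_pmf.prob (search n s M \<beta> (Suc k) [] f)
        {st. \<not> (valid_blocks n \<beta> f st \<and> miss n {i. \<beta> i \<in> fst ` set st} f f \<le> \<delta>)} + b"
    proof (rule prob_bind_le[OF b0])
      fix st assume "st \<notin> {st. \<not> (valid_blocks n \<beta> f st \<and> miss n {i. \<beta> i \<in> fst ` set st} f f \<le> \<delta>)}"
      then show "measure_pmf.prob (?F \<beta> st) {False} \<le> b"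
        unfolding b_def using \<beta>(2) by (intro finish_rejects_le[OF C fC f] \<eta> t) auto
    qed
    also have "\<dots> \<le> real (Suc k) * (1 - \<delta>) ^ M + b"
      by (intro add_right_mono prob_search_bad[OF junta f less \<delta>]) (auto simp: valid_blocks_def)
    finally show "measure_pmf.prob (bind_pmf (search n s M \<beta> (Suc k) [] f) (?F \<beta>)) {False}
      \<le> real (Suc k) * (1 - \<delta>) ^ M + b" .
  qed (use \<delta> b0 in auto)
  also have "measure_pmf.prob ?P {\<beta>. \<not> inj_on \<beta> ?R} \<le> real (k * k) / real (2 ^ s)"
    by (rule prob_not_isolating) (use junta in \<open>auto simp: depends_on_def is_junta_def\<close>)
  finally show ?thesis
    by (simp add: b_def)
qed

subsection \<open>The choice of parameters\<close>

text \<open>Use \<open>1 + y \<le> exp y\<close> and \<open>exp (- 1) \<le> 1 / 2\<close>.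
  Repetition counts are later taken as multiples of \<open>D\<close> to match this form; thus 66
  rounds against \<open>1 / 33\<close> give \<open>1 / 4\<close>.\<close>

lemma one_minus_inverse_power_le:
  assumes "0 < D"
  shows "(1 - 1 / real D) ^ (D * j) \<le> (1 / 2) ^ j"
proof -
  have "(1 - 1 / real D) ^ D \<le> exp (- 1 / real D) ^ D"
    using exp_ge_add_one_self[of "- 1 / real D"] assms by (intro power_mono) auto
  also have "\<dots> = exp (- 1)"
    using assms by (simp add: exp_of_nat_mult[symmetric])
  also have "\<dots> \<le> 1 / 2"
    using exp_ge_add_one_self[of 1] by (simp add: exp_minus field_simps)
  finally show ?thesis
    unfolding power_mult using assms by (intro power_mono) auto
qed

text \<open>The constant is \<open>454 + 792 + 6 + 6\<close>: search, dictator tests with 66 rounds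
  of 12 queries per block, samples, checks.\<close>

lemma call_count_le:
  fixes k lg m m' :: nat
  assumes "1 \<le> lg" "1 \<le> m" "m' \<le> m"
  shows "Suc k * ((32 * m * (lg + 6)) * 2 + (2 * lg + 4)) + (k * (66 * 12)
    + (m * (1 + k * (2 * (lg + 2))) + m' * (k * (2 * (lg + 2)) + 1))) \<le> 1258 * (Suc k * (m * lg))"
proof -
  have mlg: "lg \<le> m * lg" "m \<le> m * lg" "1 \<le> m * lg"
    using assms by auto
  have "Suc k * ((32 * m * (lg + 6)) * 2 + (2 * lg + 4)) \<le> Suc k * (454 * (m * lg))"
  proof (rule mult_le_mono2)
    have "(32 * m * (lg + 6)) * 2 + (2 * lg + 4) = 64 * (m * lg) + 384 * m + 2 * lg + 4"
      by (simp add: algebra_simps)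
    then show "(32 * m * (lg + 6)) * 2 + (2 * lg + 4) \<le> 454 * (m * lg)"
      using mlg by linarith
  qed
  moreover have "k * (66 * 12) \<le> Suc k * (792 * (m * lg))"
    by (rule mult_le_mono) (use mlg(3) in linarith)+
  moreover have one: "1 + k * (2 * (lg + 2)) \<le> 6 * (Suc k * lg)"
  proof -
    have "k * (2 * (lg + 2)) \<le> k * (6 * lg)"
      using assms(1) by (intro mult_le_mono2) simp
    then have "1 + k * (2 * (lg + 2)) \<le> 6 * lg + k * (6 * lg)"
      using assms(1) by linarith
    then show ?thesis
      by (simp add: distrib_left)
  qed
  moreover have "m * (1 + k * (2 * (lg + 2))) \<le> m * (6 * (Suc k * lg))"
    by (rule mult_le_mono2[OF one])
  moreover have "m' * (k * (2 * (lg + 2)) + 1) \<le> m * (6 * (Suc k * lg))"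
    using one assms(3) by (intro mult_le_mono) auto
  ultimately show ?thesis
    by (simp add: algebra_simps)
qed

lemma call_scale_ge:
  assumes "0 < \<epsilon>" "\<epsilon> < 1 / 2"
  shows "2 < call_scale n k C \<epsilon>" "max 1 (real k) \<le> call_scale n k C \<epsilon>" "1 / \<epsilon> \<le> call_scale n k C \<epsilon>"
proof -
  let ?K = "max 1 (real k)" and ?L = "max 1 (log 2 (real (card (first_vars_part n k C))))"
  have inv: "2 < 1 / \<epsilon>"
    using assms by (simp add: field_simps)
  have KL: "1 * 1 \<le> ?K * ?L"
    by (intro mult_mono) auto
  then have "1 / \<epsilon> \<le> ?K * ?L / \<epsilon>"
    using assms by (intro divide_right_mono) auto
  then show "1 / \<epsilon> \<le> call_scale n k C \<epsilon>"
    by (simp add: call_scale_def)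
  with inv show "2 < call_scale n k C \<epsilon>"
    by simp
  have "?K * 1 * 1 \<le> ?K * ?L * (1 / \<epsilon>)"
    using inv by (intro mult_mono) auto
  then show "?K \<le> call_scale n k C \<epsilon>"
    by (simp add: call_scale_def)
qed

lemma prob_bool_pmf: "pmf p True = 1 - measure_pmf.prob p {False}" "pmf p False = 1 - measure_pmf.prob p {True}"
proof -
  have "{b. b} = {True}" "{b. \<not> b} = {False}"
    by auto
  then have "measure_pmf.prob p {False} = 1 - measure_pmf.prob p {True}"
    using prob_compl_pmf[of p "\<lambda>b. b"] by simp
  then show "pmf p True = 1 - measure_pmf.prob p {False}" "pmf p False = 1 - measure_pmf.prob p {True}"
    by (simp_all add: measure_pmf_single)
qed

lemma tester_exists:
  assumes C: "junta_subclass n k C" "C \<noteq> {}" and \<epsilon>: "0 < \<epsilon>" "\<epsilon> < 1 / 2"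
  obtains alg q where "rel_error_tester n C \<epsilon> alg" "calls_le n alg q"
    "real q \<le> 126242816 * call_scale n k C \<epsilon> * log 2 (call_scale n k C \<epsilon>)"
proof -
  define Q where "Q = call_scale n k C \<epsilon>"
  define G where "G = first_vars_part n k C"
  define K where "K = max 1 (real k)"
  define L where "L = max 1 (log 2 (real (card G)))"
  note Q_ge = call_scale_ge[OF \<epsilon>, where n = n and k = k and C = C, folded Q_def K_def]
  have Q_eq: "Q = K * L / \<epsilon>"
    by (simp add: Q_def call_scale_def K_def L_def G_def)
  have log_Q: "1 \<le> log 2 Q"
    using Q_ge(1) by (simp add: le_log_iff)
  have L1: "1 \<le> L" and K1: "1 \<le> K"
    by (auto simp: L_def K_def)
  define E where "E = nat \<lceil>1 / \<epsilon>\<rceil>"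
  define \<Lambda> where "\<Lambda> = nat \<lceil>L\<rceil>"
  define lg where "lg = nat \<lceil>log 2 Q\<rceil>"
  have inv: "2 < 1 / \<epsilon>"
    using \<epsilon> by (simp add: field_simps)
  have nat_ceil: "x \<le> real (nat \<lceil>x\<rceil>) \<and> real (nat \<lceil>x\<rceil>) \<le> 2 * x" if "1 \<le> x" for x :: real
  proof
    show "x \<le> real (nat \<lceil>x\<rceil>)"
      by (rule of_nat_ceiling)
    have "real (nat \<lceil>x\<rceil>) \<le> x + 1"
      using that by linarith
    then show "real (nat \<lceil>x\<rceil>) \<le> 2 * x"
      using that by linarith
  qed
  have E: "1 / \<epsilon> \<le> real E" "real E \<le> 2 * (1 / \<epsilon>)" and \<Lambda>: "L \<le> real \<Lambda>" "real \<Lambda> \<le> 2 * L"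
    and lg: "log 2 Q \<le> real lg" "real lg \<le> 2 * log 2 Q"
    using nat_ceil[of "1 / \<epsilon>"] nat_ceil[OF L1] nat_ceil[OF log_Q] inv
    by (auto simp: E_def \<Lambda>_def lg_def)
  have E0: "0 < E" and lg1: "1 \<le> lg"
    using E inv lg log_Q by linarith+
  have Q_pow: "Q \<le> 2 ^ lg"
  proof -
    have "Q = 2 powr log 2 Q"
      using Q_ge by simp
    also have "\<dots> \<le> 2 powr real lg"
      using lg by simp
    finally show ?thesis
      by (simp add: powr_realpow)
  qed
  have card_G: "real (card G) \<le> 2 ^ \<Lambda>"
  proof (cases "card G = 0")
    case False
    then have "real (card G) = 2 powr log 2 (real (card G))"
      by simp
    also have "\<dots> \<le> 2 powr real \<Lambda>"
      using \<Lambda> by (simp add: L_def)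
    finally show ?thesis
      by (simp add: powr_realpow)
  qed simp
  \<comment> \<open>Completeness uses the threshold \<open>1 / D\<close>, soundness
    \<open>1 / (7 * E)\<close>. The \<open>m'\<close> checks overlook a share
    \<open>1 / (14 * E)\<close> with probability at most \<open>1 / 16\<close>;
    \<open>D = 32 * m'\<close> makes them hit a share \<open>2 / D\<close> with probability at most
    \<open>1 / 16\<close>.\<close>
  define m' where "m' = 14 * E * 4"
  define D where "D = 1792 * E"
  define m where "m = D * (\<Lambda> + 5)"
  \<comment> \<open>For \<open>\<delta> = 1 / (32 * m)\<close> all \<open>m\<close> samples fit
    \<open>f\<close> up to error \<open>1 / 32\<close>. The summand 6 absorbs the union over
    \<open>k + 1 \<le> 2 * 2 ^ lg\<close> rounds.\<close>
  define M where "M = 32 * m * (lg + 6)"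
  \<comment> \<open>\<open>2 ^ s = 16 * 4 ^ lg\<close> is at least \<open>16 * k * k\<close>, so a
    collision has probability at most \<open>1 / 16\<close>.\<close>
  define s where "s = 2 * lg + 4"
  \<comment> \<open>\<open>8 ^ t = 64 * 8 ^ lg\<close> is at least \<open>14 * E * k\<close>, since
    \<open>k\<close> and \<open>E / 2\<close> are at most \<open>2 ^ lg\<close>; this pushes the
    decoding error of \<open>k\<close> blocks below \<open>1 / (14 * E)\<close>.\<close>
  define t where "t = lg + 2"
  define q where "q = Suc k * (M * 2 + s) + (k * (66 * 12) + (m * (1 + k * (2 * t)) + m' * (k * (2 * t) + 1)))"
  obtain alg where alg: "\<And>f. run n f alg = tester n k s M 66 t m m' G f" "calls_le n alg q"
    using computes_algorithm[OF computes_tester, of n k s M 66 t m m' G] unfolding q_def by blast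
  have m0: "0 < m" and D0: "0 < D"
    using E0 by (auto simp: m_def D_def)
  have finC: "finite C"
    using C finite_boolfuns[of n] by (auto simp: junta_subclass_def intro: finite_subset)
  have card_pow: "real (card G) * (1 / 2) ^ (\<Lambda> + 5) \<le> 1 / 32"
  proof -
    have "real (card G) * (1 / 2) ^ (\<Lambda> + 5) \<le> 2 ^ \<Lambda> * (1 / 2) ^ (\<Lambda> + 5)"
      using card_G by (intro mult_right_mono) auto
    also have "\<dots> = 1 / 32"
      by (simp add: power_add power_one_over)
    finally show ?thesis .
  qed
  have "real k \<le> Q"
    using Q_ge(2) by (simp add: K_def)
  then have k_pow: "real k \<le> 2 ^ lg"
    using Q_pow by (rule order_trans)
  have accept: "2 / 3 \<le> pmf (run n f alg) True" if f: "sat n f \<noteq> {}" "f \<in> C" for f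
  proof -
    have "measure_pmf.prob (run n f alg) {False}
      \<le> real (k * k) / 2 ^ s + real (Suc k) * (1 - 1 / real (32 * m)) ^ M +
      (real m * (1 / real (32 * m)) + real (card G) * (1 - 1 / real D) ^ m + real m' * (2 * (1 / real D)))"
      unfolding alg G_def
    proof (rule tester_rejects_le[OF C(1) f(2,1)])
      show "1 / real (32 * m) \<le> 1"
        using m0 by simp
      have "2 \<le> real D"
        using E0 by (simp add: D_def)
      then show "1 / real D \<le> 1 / 2"
        by (intro divide_left_mono) auto
    qed (simp_all add: t_def)
    also have "\<dots> \<le> 1 / 16 + 1 / 32 + (1 / 32 + 1 / 32 + 1 / 16)"
    proof (intro add_mono)
      have "real (k * k) \<le> 2 ^ lg * 2 ^ lg"
        unfolding of_nat_mult using k_pow by (intro mult_mono) auto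
      also have "\<dots> = 2 ^ s / 16"
        unfolding s_def mult_2 power_add by simp
      finally have "real (k * k) / 2 ^ s \<le> 2 ^ s / 16 / 2 ^ s"
        by (rule divide_right_mono) simp
      then show "real (k * k) / 2 ^ s \<le> 1 / 16"
        by simp
      have "real (Suc k) * (1 - 1 / real (32 * m)) ^ M \<le> real (Suc k) * (1 / 2) ^ (lg + 6)"
        unfolding M_def using m0 by (intro mult_left_mono one_minus_inverse_power_le) auto
      also have "\<dots> \<le> (2 * 2 ^ lg) * (1 / 2) ^ (lg + 6)"
      proof (rule mult_right_mono)
        have "1 \<le> (2 :: real) ^ lg"
          by simp
        then show "real (Suc k) \<le> 2 * 2 ^ lg"
          using k_pow unfolding of_nat_Suc by linarith
      qed simp
      also have "\<dots> = 1 / 32"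
        by (simp add: power_add power_one_over)
      finally show "real (Suc k) * (1 - 1 / real (32 * m)) ^ M \<le> 1 / 32" .
      show "real m * (1 / real (32 * m)) \<le> 1 / 32"
        using m0 by simp
      have "real (card G) * (1 - 1 / real D) ^ m \<le> real (card G) * (1 / 2) ^ (\<Lambda> + 5)"
        unfolding m_def using D0 by (intro mult_left_mono one_minus_inverse_power_le) auto
      then show "real (card G) * (1 - 1 / real D) ^ m \<le> 1 / 32"
        using card_pow by simp
      show "real m' * (2 * (1 / real D)) \<le> 1 / 16"
        using E0 by (simp add: m'_def D_def)
    qed
    finally show ?thesis
      by (simp add: prob_bool_pmf)
  qed
  have reject: "2 / 3 \<le> pmf (run n f alg) False"
    if f: "sat n f \<noteq> {}" and far: "ereal \<epsilon> \<le> rel_dist_class n f C" for f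
  proof -
    \<comment> \<open>The factor 7 makes \<open>6 * \<eta> < \<epsilon>\<close> strict, since
      \<open>rel_dist\<close> may equal \<open>\<epsilon>\<close>.\<close>
    define \<eta> where "\<eta> = 1 / real (7 * E)"
    have half: "1 - \<eta> / 2 = 1 - 1 / real (14 * E)"
      by (simp add: \<eta>_def)
    have "\<epsilon> \<le> rel_dist n f g" if "g \<in> C" for g
    proof -
      have "\<epsilon> \<le> Min (rel_dist n f ` C)"
        using far C(2) by (simp add: rel_dist_class_def)
      also have "\<dots> \<le> rel_dist n f g"
        using finC that by simp
      finally show ?thesis .
    qed
    moreover have "6 * \<eta> < \<epsilon>"
      using E(1) E0 \<epsilon> by (simp add: \<eta>_def field_simps)
    ultimately have dist: "6 * \<eta> < rel_dist n f g" if "g \<in> C" for g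
      using that by fastforce
    have "measure_pmf.prob (run n f alg) {True} \<le> 1 / 3"
      unfolding alg
    proof (rule tester_accepts_le[OF C(1) f dist])
      show "0 \<le> \<eta>" "\<eta> \<le> 1 / 2"
        using E0 by (auto simp: \<eta>_def field_simps)
      show "G \<subseteq> C"
        by (auto simp: G_def first_vars_part_def)
      have "(32 / 33 :: real) ^ 66 \<le> (1 / 2) ^ 2"
        using one_minus_inverse_power_le[of 33 2] by simp
      then show "(32 / 33 :: real) ^ 66 \<le> 1 / 3"
        by (simp add: power2_eq_square)
      have "14 * real E * real k \<le> 14 * (2 * 2 ^ lg) * 2 ^ lg"
        using E(2) Q_ge(3) Q_pow k_pow by (intro mult_mono) auto
      also have "\<dots> \<le> 2 ^ 5 * 2 ^ lg * 2 ^ lg"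
        by simp
      also have "\<dots> \<le> 2 ^ 6 * 2 ^ lg * 2 ^ lg * 2 ^ lg"
      proof -
        have "2 ^ 5 * 2 ^ lg * 2 ^ lg * 1 \<le> 2 ^ 6 * 2 ^ lg * 2 ^ lg * (2 :: real) ^ lg"
          by (intro mult_mono) auto
        then show ?thesis
          by (simp only: mult_1_right)
      qed
      also have "\<dots> = 8 ^ t"
        by (simp add: t_def power_add power_mult_distrib[symmetric])
      finally have "14 * real E * real k / 8 ^ t \<le> 1"
        by simp
      then have "14 * real E * real k / 8 ^ t * (\<eta> / 2) \<le> 1 * (\<eta> / 2)"
        by (rule mult_right_mono) (simp add: \<eta>_def)
      moreover have "14 * real E * real k / 8 ^ t * (\<eta> / 2) = real k * (1 / 8) ^ t"
        using E0 by (simp add: \<eta>_def power_one_over)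
      ultimately show "real k * (1 / 8) ^ t \<le> \<eta> / 2"
        by simp
      have "(1 - \<eta> / 2) ^ m = (1 - 1 / real (14 * E)) ^ (14 * E * (128 * (\<Lambda> + 5)))"
        unfolding half by (simp add: m_def D_def algebra_simps)
      also have "\<dots> \<le> (1 / 2) ^ (128 * (\<Lambda> + 5))"
        using E0 by (intro one_minus_inverse_power_le) simp
      also have "\<dots> \<le> (1 / 2) ^ (\<Lambda> + 5)"
        by (rule power_decreasing) auto
      finally have "real (card G) * (1 - \<eta> / 2) ^ m \<le> real (card G) * (1 / 2) ^ (\<Lambda> + 5)"
        by (intro mult_left_mono) auto
      with card_pow have "real (card G) * (1 - \<eta> / 2) ^ m \<le> 1 / 32"
        by simp
      moreover have "(1 - \<eta> / 2) ^ m' \<le> (1 / 2) ^ 4"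
        unfolding half m'_def using E0 by (intro one_minus_inverse_power_le) simp
      ultimately show "real (card G) * (1 - \<eta> / 2) ^ m + (1 - \<eta> / 2) ^ m' \<le> 1 / 3"
        by (simp add: power4_eq_xxxx)
    qed
    then show ?thesis
      by (simp add: prob_bool_pmf)
  qed
  have "rel_error_tester n C \<epsilon> alg"
    unfolding rel_error_tester_def using accept reject by blast
  moreover note alg(2)
  moreover have "real q \<le> 126242816 * Q * log 2 Q"
  proof -
    have "m' \<le> m"
      by (simp add: m_def m'_def D_def)
    then have "q \<le> 1258 * (Suc k * (m * lg))"
      unfolding q_def M_def s_def t_def using lg1 m0 by (intro call_count_le) auto
    then have "real q \<le> real (1258 * (Suc k * (m * lg)))"
      by (rule of_nat_mono)
    also have "\<dots> = 1258 * (real (Suc k) * (1792 * (real E * (real \<Lambda> + 5)) * real lg))"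
      by (simp add: m_def D_def algebra_simps)
    \<comment> \<open>\<open>Suc k\<close>, \<open>E\<close> and \<open>lg\<close> cost a factor 2
      each and \<open>\<Lambda> + 5\<close> costs 7, whence
      \<open>1258 * 1792 * 8 * 7\<close>.\<close>
    also have "\<dots> \<le> 1258 * ((2 * K) * (1792 * ((2 * (1 / \<epsilon>)) * (7 * L)) * (2 * log 2 Q)))"
    proof (intro mult_left_mono mult_mono E lg)
      show "real (Suc k) \<le> 2 * K"
        by (simp add: K_def)
      show "real \<Lambda> + 5 \<le> 7 * L"
        using \<Lambda> L1 by simp
    qed (use K1 L1 \<epsilon> log_Q in auto)
    also have "\<dots> = 126242816 * Q * log 2 Q"
      by (simp add: Q_eq)
    finally show ?thesis .
  qed
  ultimately show thesis
    using that unfolding Q_def by blast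
qed

theorem theorem1p2:
  shows "\<exists>(A::real) (b::nat). \<forall>(n::nat) (k::nat) (C::boolfun set) (\<epsilon>::real).
    junta_subclass n k C \<and> 0 < \<epsilon> \<and> \<epsilon> < 1 / 2 \<longrightarrow>
    (\<exists>alg q. rel_error_tester n C \<epsilon> alg \<and> calls_le n alg q \<and>
       real q \<le> A * call_scale n k C \<epsilon> * (log 2 (call_scale n k C \<epsilon>)) ^ b)"
proof (intro exI[of _ "126242816 :: real"] exI[of _ "1 :: nat"] allI impI)
  fix n k C \<epsilon> assume as: "junta_subclass n k C \<and> 0 < \<epsilon> \<and> \<epsilon> < (1 / 2 :: real)"
  show "\<exists>alg q. rel_error_tester n C \<epsilon> alg \<and> calls_le n alg q \<and>
       real q \<le> 126242816 * call_scale n k C \<epsilon> * (log 2 (call_scale n k C \<epsilon>)) ^ 1"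
  proof (cases "C = {}")
    \<comment> \<open>Every function is infinitely far from the empty class, so rejection without
      any call is correct.\<close>
    case True
    then have "rel_error_tester n C \<epsilon> (Output False)"
      by (simp add: rel_error_tester_def)
    moreover have "0 \<le> call_scale n k C \<epsilon> * log 2 (call_scale n k C \<epsilon>)"
      using call_scale_ge(1)[of \<epsilon> n k C] as by simp
    ultimately show ?thesis
      by (intro exI[of _ "Output False"] exI[of _ "0 :: nat"]) simp
  next
    case False
    then show ?thesis
      using tester_exists[of n k C \<epsilon>] as by (metis power_one_right)
  qed
qed

end
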